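(* (1) Every join-semilattice with at most seven elements is planar. (2) The join-semilattice reduct $(A_0;\vee)$ of the eight-element Boolean lattice is a non-planar eight-element semilattice with exactly $121$ subsemilattices. (3) Every eight-element join-semilattice with at least $122$ subsemilattices is planar.
   Context: A (join-)semilattice $(L;\vee)$ is a nonempty set $L$ with a commutative, associative, idempotent binary operation $\vee$; it is regarded as a poset via $x\le y \iff x\vee y=y$, so that $x\vee y$ is the least upper bound of $x$ and $y$. A subsemilattice of $L$ is a nonempty subset of $L$ closed under $\vee$. The eight-element Boolean lattice $A_0$ is the lattice of all subsets of a three-element set, ordered by inclusion, with $\vee$ being union. A Hasse diagram of a finite poset represents its elements by distinct points of the plane and each covering pair $x\prec y$ by a straight line segment from $x$ up to $y$, where $y$ has a strictly larger vertical coordinate than $x$ (and no segment passes through a point representing an element other than its endpoints). A finite semilattice is planar if its underlying poset has a Hasse diagram that is also a planar representation of a graph, i.e., one in which no two segments meet except possibly at common endpoints; otherwise it is non-planar. *)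

theory Defs
  imports "HOL-Analysis.Analysis"
begin

locale join_semilattice_on =
  fixes L :: "'a set" and join :: "'a \<Rightarrow> 'a \<Rightarrow> 'a"
  assumes nonempty: "L \<noteq> {}"
    and closed: "\<lbrakk>x \<in> L; y \<in> L\<rbrakk> \<Longrightarrow> join x y \<in> L"
    and assoc: "\<lbrakk>x \<in> L; y \<in> L; z \<in> L\<rbrakk> \<Longrightarrow> join (join x y) z = join x (join y z)"
    and commute: "\<lbrakk>x \<in> L; y \<in> L\<rbrakk> \<Longrightarrow> join x y = join y x"
    and idem: "x \<in> L \<Longrightarrow> join x x = x"

lemma join_semilattice_on_UNIV: "join_semilattice_on UNIV f \<longleftrightarrow> semilattice f"
  unfolding join_semilattice_on_def semilattice_def semilattice_axioms_def
    abel_semigroup_def abel_semigroup_axioms_def semigroup_def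
  by auto

definition subsemilattices :: "'a set \<Rightarrow> ('a \<Rightarrow> 'a \<Rightarrow> 'a) \<Rightarrow> 'a set set" where
  "subsemilattices L join =
     {S. S \<noteq> {} \<and> S \<subseteq> L \<and> (\<forall>x\<in>S. \<forall>y\<in>S. join x y \<in> S)}"

definition join_le :: "('a \<Rightarrow> 'a \<Rightarrow> 'a) \<Rightarrow> 'a \<Rightarrow> 'a \<Rightarrow> bool" where
  "join_le join x y \<longleftrightarrow> join x y = y"

definition coverings :: "'a set \<Rightarrow> ('a \<Rightarrow> 'a \<Rightarrow> bool) \<Rightarrow> ('a \<times> 'a) set" where
  "coverings P le =
     {(x, y). x \<in> P \<and> y \<in> P \<and> le x y \<and> x \<noteq> y \<and>
        (\<forall>z\<in>P. le x z \<and> le z y \<longrightarrow> z = x \<or> z = y)}"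

text \<open>A diagram is given by the placement \<open>pos\<close> of the elements in the plane; its edges are then
  the straight segments between the endpoints of the covering pairs.\<close>

definition hasse_diagram :: "'a set \<Rightarrow> ('a \<Rightarrow> 'a \<Rightarrow> bool) \<Rightarrow> ('a \<Rightarrow> real \<times> real) \<Rightarrow> bool" where
  "hasse_diagram P le pos \<longleftrightarrow>
     inj_on pos P \<and>
     (\<forall>(x, y) \<in> coverings P le.
        snd (pos x) < snd (pos y) \<and>
        (\<forall>z\<in>P. pos z \<in> closed_segment (pos x) (pos y) \<longrightarrow> z = x \<or> z = y))"

definition crossing_free :: "'a set \<Rightarrow> ('a \<Rightarrow> 'a \<Rightarrow> bool) \<Rightarrow> ('a \<Rightarrow> real \<times> real) \<Rightarrow> bool" where
  "crossing_free P le pos \<longleftrightarrow>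
     (\<forall>(x, y) \<in> coverings P le. \<forall>(u, v) \<in> coverings P le. (x, y) \<noteq> (u, v) \<longrightarrow>
        closed_segment (pos x) (pos y) \<inter> closed_segment (pos u) (pos v)
          \<subseteq> {pos x, pos y} \<inter> {pos u, pos v})"

definition planar_poset :: "'a set \<Rightarrow> ('a \<Rightarrow> 'a \<Rightarrow> bool) \<Rightarrow> bool" where
  "planar_poset P le \<longleftrightarrow> (\<exists>pos. hasse_diagram P le pos \<and> crossing_free P le pos)"

definition planar_semilattice :: "'a set \<Rightarrow> ('a \<Rightarrow> 'a \<Rightarrow> 'a) \<Rightarrow> bool" where
  "planar_semilattice L join \<longleftrightarrow> planar_poset L (join_le join)"

definition A0 :: "nat set set" where
  "A0 = Pow {0, 1, 2}"

end

theory Submission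
  imports Defs
begin

text \<open>Planarity of most small semilattices has a single reason. If the order of a finite
  semilattice is the intersection of two linear orders, given by coordinates \<open>f\<close> and \<open>g\<close>, then
  placing \<open>x\<close> at \<open>(f x - g x, f x + g x)\<close> draws it without crossings: a point common to the edges
  \<open>x < y\<close> and \<open>u < v\<close> lies coordinatewise between their ends, so \<open>x \<le> v\<close> and \<open>u \<le> y\<close>, and \<open>x \<squnion>
  u\<close>, which lies between the two ends of either covering pair, is a common end of the two edges
  (\<open>planar_if_two_dimensional\<close>). Moreover, a minimal element with a single upper cover may be
  removed, because a short pendant edge can be added to every drawing
  (\<open>planar_poset_add_pendant\<close>).

  It remains to look at the semilattices without such pendant elements. Listing the elements from
  the top downwards, every new element is described by the set of its strict upper bounds among
  the earlier ones; this turns a semilattice into a triangular bit matrix in which joins are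
  bitwise conjunctions. One may list the elements so that these rows increase lexicographically
  (\<open>ex_listing\<close>), which removes most of the repetitions caused by different listings of the same
  semilattice, and \<open>new_rows\<close> yields all rows by which a matrix can be extended. A depth-first
  search through all matrices of size at most eight (\<open>explored\<close>) then shows, for those without
  pendant elements: at size at most seven, all have a realizer by two linear orders except the
  semilattice of the non-zero elements of the eight-element Boolean lattice, and at size eight,
  those without a realizer have at most 121 subsemilattices, or are one semilattice with 123 of
  them, which occurs under two listings. The exceptional ones are drawn explicitly in \<open>atlas\<close>.

  In the eight-element Boolean lattice itself, consider the edges from the bottom \<open>p\<close> to the atoms
  \<open>a\<close>, \<open>b\<close>, \<open>c\<close>, in the order of their slopes. The chains from \<open>p\<close> over \<open>a\<close> and over \<open>c\<close> to \<open>a \<squnion>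
  c\<close> enclose a region. Any chain from \<open>p\<close> over the middle atom \<open>b\<close> to the top starts in this
  region and has to leave it, since the top is above \<open>a \<squnion> c\<close>; by the intermediate value theorem
  it meets the boundary (\<open>no_trapped_chain\<close>).\<close>

section \<open>Drawings of finite posets\<close>

lemma planar_poset_transfer:
  assumes inj: "inj_on \<phi> P"
    and le: "\<And>x y. x \<in> P \<Longrightarrow> y \<in> P \<Longrightarrow> le x y \<longleftrightarrow> le' (\<phi> x) (\<phi> y)"
    and planar: "planar_poset (\<phi> ` P) le'"
  shows "planar_poset P le"
proof -
  obtain pos where h: "hasse_diagram (\<phi> ` P) le' pos" and c: "crossing_free (\<phi> ` P) le' pos"
    using planar unfolding planar_poset_def by blast
  have eq: "\<phi> x = \<phi> y \<longleftrightarrow> x = y" if "x \<in> P" "y \<in> P" for x y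
    using inj that by (auto dest: inj_onD)
  have cov: "(\<phi> x, \<phi> y) \<in> coverings (\<phi> ` P) le'" if "(x, y) \<in> coverings P le" for x y
    using that le eq by (auto simp: coverings_def)
  have covP: "x \<in> P" "y \<in> P" if "(x, y) \<in> coverings P le" for x y
    using that by (auto simp: coverings_def)
  have "hasse_diagram P le (pos \<circ> \<phi>)"
    unfolding hasse_diagram_def
  proof (intro conjI ballI)
    show "inj_on (pos \<circ> \<phi>) P"
      using h inj by (simp add: hasse_diagram_def comp_inj_on)
    fix p assume p: "p \<in> coverings P le"
    obtain x y where [simp]: "p = (x, y)" by fastforce
    have "snd (pos (\<phi> x)) < snd (pos (\<phi> y)) \<and>
      (\<forall>z\<in>P. pos (\<phi> z) \<in> closed_segment (pos (\<phi> x)) (pos (\<phi> y)) \<longrightarrow> \<phi> z = \<phi> x \<or> \<phi> z = \<phi> y)"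
      using h cov p unfolding hasse_diagram_def by fastforce
    then show "case p of (x, y) \<Rightarrow> snd ((pos \<circ> \<phi>) x) < snd ((pos \<circ> \<phi>) y) \<and>
        (\<forall>z\<in>P. (pos \<circ> \<phi>) z \<in> closed_segment ((pos \<circ> \<phi>) x) ((pos \<circ> \<phi>) y) \<longrightarrow> z = x \<or> z = y)"
      using covP p eq by auto
  qed
  moreover have "crossing_free P le (pos \<circ> \<phi>)"
    unfolding crossing_free_def
  proof clarify
    fix x y u v p
    assume xy: "(x, y) \<in> coverings P le" and uv: "(u, v) \<in> coverings P le"
      and ne: "\<not> (x = u \<and> y = v)"
      and p: "p \<in> closed_segment ((pos \<circ> \<phi>) x) ((pos \<circ> \<phi>) y)"
        "p \<in> closed_segment ((pos \<circ> \<phi>) u) ((pos \<circ> \<phi>) v)"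
    have "(\<phi> x, \<phi> y) \<noteq> (\<phi> u, \<phi> v)" using ne covP[OF xy] covP[OF uv] eq by simp
    then show "p \<in> {(pos \<circ> \<phi>) x, (pos \<circ> \<phi>) y} \<inter> {(pos \<circ> \<phi>) u, (pos \<circ> \<phi>) v}"
      using c cov[OF xy] cov[OF uv] p unfolding crossing_free_def by fastforce
  qed
  ultimately show ?thesis unfolding planar_poset_def by blast
qed

lemma segment_coord:
  fixes a b :: "real \<times> real"
  assumes "p \<in> closed_segment a b"
  shows "\<exists>t. 0 \<le> t \<and> t \<le> 1 \<and> fst p = fst a + t * (fst b - fst a) \<and> snd p =
    snd a + t * (snd b - snd a)"
proof -
  obtain t where t: "0 \<le> t" "t \<le> 1" "p = (1 - t) *\<^sub>R a + t *\<^sub>R b"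
    using assms by (auto simp: in_segment)
  have "fst p = fst a + t * (fst b - fst a)" "snd p = snd a + t * (snd b - snd a)"
    unfolding t(3) by (simp_all add: algebra_simps)
  with t show ?thesis by blast
qed

text \<open>A vector \<open>(k, -1)\<close> pointing downwards is parallel to \<open>e\<close> for only one \<open>k\<close>, so almost every
  \<open>k\<close> avoids the finitely many directions of given edges.\<close>

lemma pendant_direction:
  fixes E :: "(real \<times> real) set"
  assumes "finite E" "\<And>e. e \<in> E \<Longrightarrow> snd e \<noteq> 0"
  shows "\<exists>k. \<forall>e\<in>E. fst e + k * snd e \<noteq> 0"
proof -
  have "infinite (UNIV :: real set)" by (simp add: infinite_UNIV_char_0)
  then obtain k where k: "k \<notin> (\<lambda>e. - fst e / snd e) ` E"
    using assms(1) by (metis UNIV_I ex_new_if_finite finite_imageI)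
  have "fst e + k * snd e \<noteq> 0" if "e \<in> E" for e
  proof
    assume "fst e + k * snd e = 0"
    then have "k = - fst e / snd e" using assms(2)[OF that] by (simp add: field_simps)
    then show False using k that by blast
  qed
  then show ?thesis by blast
qed

text \<open>The new point is put just below \<open>y\<close>: the segments not ending in \<open>y\<close> and the other vertices
  form a closed set that stays away from a disc around \<open>y\<close>, and the edges at \<open>y\<close> are avoided by
  the choice of the direction. The upper bounds of \<open>x\<close> other than \<open>x\<close> being those of \<open>y\<close> says
  that \<open>y\<close> is the only upper cover of \<open>x\<close>.\<close>

lemma planar_poset_add_pendant:
  fixes P :: "'a set"
  assumes fin: "finite P" and x: "x \<in> P" and y: "y \<in> P" "x \<noteq> y"
    and up: "\<And>z. z \<in> P \<Longrightarrow> z \<noteq> x \<Longrightarrow> le x z \<longleftrightarrow> le y z"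
    and refl: "le y y"
    and minimal: "\<And>z. z \<in> P \<Longrightarrow> le z x \<Longrightarrow> z = x"
    and antisym: "\<And>z. z \<in> P \<Longrightarrow> le y z \<Longrightarrow> le z y \<Longrightarrow> z = y"
    and planar: "planar_poset (P - {x}) le"
  shows "planar_poset P le"
proof -
  let ?Q = "P - {x}"
  define C where "C = coverings ?Q le"
  obtain pos where h: "hasse_diagram ?Q le pos" and c: "crossing_free ?Q le pos"
    using planar unfolding planar_poset_def by blast
  have CQ: "u \<in> ?Q" "v \<in> ?Q" if "(u, v) \<in> C" for u v using that by (auto simp: C_def coverings_def)
  have cov: "coverings P le = insert (x, y) C"
  proof -
    have "(u, v) \<in> coverings P le \<longleftrightarrow> (u, v) = (x, y) \<or> (u, v) \<in> C" for u v
    proof (cases "u = x")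
      case True
      have "(x, v) \<in> coverings P le \<longleftrightarrow> v = y"
      proof
        assume "(x, v) \<in> coverings P le"
        then have v: "v \<in> P" "le x v" "v \<noteq> x" "\<And>z. z \<in> P \<Longrightarrow> le x z \<Longrightarrow> le z v \<Longrightarrow> z = x \<or> z = v"
          by (auto simp: coverings_def)
        then have "le y v" using up by auto
        moreover have "le x y" using up y refl by auto
        ultimately show "v = y" using v(4)[OF y(1)] y by auto
      next
        assume [simp]: "v = y"
        show "(x, v) \<in> coverings P le"
          using x y up refl minimal antisym unfolding coverings_def by auto
      qed
      then show ?thesis using True CQ by blast
    next
      case False
      have "v \<noteq> x" if "u \<in> P" "le u v" using minimal that False by blast
      then show ?thesis using False minimal unfolding C_def coverings_def by blast
    qed
    then show ?thesis by auto
  qed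
  have finC: "finite C"
    by (rule finite_subset[of _ "P \<times> P"]) (use fin in \<open>auto simp: C_def coverings_def\<close>)
  have ysQ: "y \<in> ?Q" using y by simp
  have up_snd: "snd (pos u) < snd (pos v)" if "(u, v) \<in> C" for u v
    using h that unfolding hasse_diagram_def C_def by blast
  have on_edge: "z = u \<or> z = v" if "(u, v) \<in> C" "z \<in> ?Q" "pos z \<in> closed_segment (pos u) (pos v)"
    for u v z
    using h that unfolding hasse_diagram_def C_def by blast
  have inj: "inj_on pos ?Q" using h unfolding hasse_diagram_def by blast
  define p where "p = pos y"
  \<comment> \<open>directions of the edges at \<open>y\<close>, seen from \<open>y\<close>\<close>
  \<comment> \<open>the edges at \<open>y\<close>, as vectors starting in \<open>y\<close>\<close>
  define E where "E = (\<lambda>(u, v). if u = y then pos v - p else pos u - p) ` {e \<in> C. fst e = y \<or>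
    snd e = y}"
  have "snd e \<noteq> 0" if "e \<in> E" for e
    using that up_snd by (auto simp: E_def p_def split: if_splits) force+
  moreover have "finite E" unfolding E_def using finC by auto
  ultimately obtain k where k: "\<And>e. e \<in> E \<Longrightarrow> fst e + k * snd e \<noteq> 0"
    using pendant_direction[of E] by blast
  define far where "far = (\<Union>(u, v)\<in>{e \<in> C. fst e \<noteq> y \<and>
    snd e \<noteq> y}. closed_segment (pos u) (pos v)) \<union> pos ` (?Q - {y})"
  have "closed far"
    unfolding far_def using finC fin
    by (intro closed_Un closed_UN finite_imp_closed) (auto simp: closed_segment split: prod.splits)
  moreover have "p \<notin> far"
    using on_edge ysQ inj unfolding far_def p_def by (auto dest: inj_onD)
  ultimately obtain \<epsilon> where \<epsilon>: "0 < \<epsilon>" "ball p \<epsilon> \<inter> far = {}"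
    by (metis open_Compl open_contains_ball ComplI disjoint_eq_subset_Compl)
  define d where "d = (k, -1 :: real)"
  define t where "t = \<epsilon> / (2 * norm d)"
  have d0: "d \<noteq> 0" by (simp add: d_def zero_prod_def)
  have t: "0 < t" using \<epsilon> d0 by (simp add: t_def)
  define q where "q = p + t *\<^sub>R d"
  have sndq: "snd q = snd p - t" and fstq: "fst q = fst p + t * k" by (auto simp: q_def d_def)
  have near: "r \<notin> far" if "r \<in> closed_segment q p" for r
  proof -
    have "dist p q < \<epsilon>" using \<epsilon> d0 t by (simp add: q_def t_def dist_norm)
    then have "closed_segment q p \<subseteq> ball p \<epsilon>"
      using \<epsilon> by (intro closed_segment_subset) auto
    then show ?thesis using that \<epsilon> by blast
  qed
  have at_y: "r = p" if r: "r \<in> closed_segment q p" "r \<in> closed_segment (pos u) (pos v)"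
    and uv: "(u, v) \<in> C" for u v r
  proof -
    have "u = y \<or> v = y" using near[OF r(1)] r(2) uv unfolding far_def by force
    define w where "w = (if u = y then v else u)"
    have seg: "r \<in> closed_segment p (pos w)"
      using r(2) \<open>u = y \<or> v = y\<close> by (auto simp: w_def p_def closed_segment_commute)
    have "pos w - p \<in> E" unfolding E_def using uv \<open>u = y \<or> v = y\<close>
      by (force simp: w_def)
    then have nz: "fst (pos w) - fst p + k * (snd (pos w) - snd p) \<noteq> 0" using k[of "pos w - p"]
      by simp
    obtain a where a: "fst r = fst q + a * (fst p - fst q)" "snd r = snd q + a * (snd p - snd q)"
      using segment_coord[OF r(1)] by blast
    obtain b where b: "fst r = fst p + b * (fst (pos w) - fst p)"
      "snd r = snd p + b * (snd (pos w) - snd p)"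
      using segment_coord[OF seg] by blast
    have bx: "b * (fst (pos w) - fst p) = k * ((1 - a) * t)"
      using a(1) b(1) unfolding fstq by algebra
    have bz: "b * (snd (pos w) - snd p) = - ((1 - a) * t)"
      using a(2) b(2) unfolding sndq by algebra
    have "b * (fst (pos w) - fst p + k * (snd (pos w) - snd p)) =
      b * (fst (pos w) - fst p) + k * (b * (snd (pos w) - snd p))"
      by (simp add: algebra_simps)
    then have "b * (fst (pos w) - fst p + k * (snd (pos w) - snd p)) = 0" unfolding bx bz by simp
    then have "b = 0" using nz by simp
    then show ?thesis using b by (simp add: prod_eq_iff)
  qed
  define pos' where "pos' = pos(x := q)"
  have pos'[simp]: "pos' x = q" "\<And>z. z \<noteq> x \<Longrightarrow> pos' z = pos z" by (auto simp: pos'_def)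
  have qfar: "q \<notin> far" using near by auto
  have qp: "q \<noteq> p" using sndq t by auto
  have q_new: "q \<noteq> pos z" if "z \<in> ?Q" for z
    using that qfar qp by (auto simp: far_def p_def)
  have posC[simp]: "pos' u = pos u" "pos' v = pos v" if "(u, v) \<in> C" for u v
    using CQ[OF that] by auto
  have "hasse_diagram P le pos'"
    unfolding hasse_diagram_def cov
  proof (intro conjI ballI)
    show "inj_on pos' P"
    proof (rule inj_onI)
      fix u v assume uv: "u \<in> P" "v \<in> P" "pos' u = pos' v"
      show "u = v"
      proof (cases "u = x \<or> v = x")
        case True
        then show ?thesis using uv q_new[of u] q_new[of v] by (cases "u = x"; cases "v = x") auto
      next
        case False
        then show ?thesis using uv inj by (auto dest: inj_onD)
      qed
    qed
    fix e assume "e \<in> insert (x, y) C"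
    then consider "e = (x, y)" | u v where "e = (u, v)" "(u, v) \<in> C" by (cases e) auto
    then show "case e of (u, v) \<Rightarrow> snd (pos' u) < snd (pos' v) \<and>
        (\<forall>z\<in>P. pos' z \<in> closed_segment (pos' u) (pos' v) \<longrightarrow> z = u \<or> z = v)"
    proof cases
      case 1
      have "z = x \<or> z = y" if z: "z \<in> P" "pos' z \<in> closed_segment q p" for z
        using near[OF z(2)] z(1) unfolding far_def by (cases "z = x") auto
      then show ?thesis using 1 y sndq t by (auto simp: p_def)
    next
      case 2
      have "z = u \<or> z = v" if z: "z \<in> P" "pos' z \<in> closed_segment (pos u) (pos v)" for z
      proof (cases "z = x")
        case True
        then show ?thesis using at_y[OF _ _ 2(2), of q] z qp by auto
      next
        case False
        then show ?thesis using on_edge[OF 2(2), of z] z by auto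
      qed
      then show ?thesis using 2 up_snd by auto
    qed
  qed
  moreover have "crossing_free P le pos'"
    unfolding crossing_free_def cov
  proof (clarify)
    fix u v a b r
    assume uv: "(u, v) \<in> insert (x, y) C" and ab: "(a, b) \<in> insert (x, y) C"
      and ne: "\<not> (u = a \<and> v = b)"
      and r: "r \<in> closed_segment (pos' u) (pos' v)" "r \<in> closed_segment (pos' a) (pos' b)"
    have mixed: "r \<in> {pos' x, pos' y} \<inter> {pos' u, pos' v}"
      if "(u, v) \<in> C" "r \<in> closed_segment (pos' x) (pos' y)"
        "r \<in> closed_segment (pos' u) (pos' v)" for u v
    proof -
      have rp: "r = p" using at_y[of r u v] that y by (auto simp: p_def)
      then have "y = u \<or> y = v" using on_edge[OF that(1) ysQ] that by (auto simp: p_def)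
      then show ?thesis using rp y by (auto simp: p_def)
    qed
    consider "(u, v) \<in> C" "(a, b) \<in> C" | "(u, v) = (x, y)" "(a, b) \<in> C" | "(u, v) \<in> C"
      "(a, b) = (x, y)"
      using uv ab ne by blast
    then show "r \<in> {pos' u, pos' v} \<inter> {pos' a, pos' b}"
    proof cases
      case 1
      then have "closed_segment (pos u) (pos v) \<inter> closed_segment (pos a) (pos b) \<subseteq> {pos u,
        pos v} \<inter> {pos a, pos b}"
        using c ne unfolding crossing_free_def C_def by fastforce
      then show ?thesis using r 1 by auto
    next
      case 2 then show ?thesis using mixed[of a b] r by auto
    next
      case 3 then show ?thesis using mixed[of u v] r by auto
    qed
  qed
  ultimately show ?thesis unfolding planar_poset_def by blast
qed

section \<open>Semilattices of order dimension two\<close>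

text \<open>Two edges with a common end that meet in another point have the same direction, so the
  longer one dominates the shorter one in both coordinates.\<close>

lemma parallel_cases:
  fixes s t :: real
  assumes "s * a = t * b" "s * a' = t * b'" "0 < s" "0 \<le> t" "0 \<le> a" "0 \<le> a'" "0 \<le> b" "0 \<le> b'"
    and "a \<noteq> 0 \<or> a' \<noteq> 0"
  shows "a \<le> b \<and> a' \<le> b' \<or> b \<le> a \<and> b' \<le> a'"
proof (cases "t \<le> s")
  case True
  then have "s * a \<le> s * b" "s * a' \<le> s * b'" using assms by (auto simp: mult_right_mono)
  then have "a \<le> b" "a' \<le> b'" using assms(3) by (auto simp: mult_le_cancel_left_pos)
  then show ?thesis by simp
next
  case False
  then have "t * b \<le> t * a" "t * b' \<le> t * a'" "0 < t"
    using assms mult_right_mono[of s t a] mult_right_mono[of s t a'] by auto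
  then have "b \<le> a" "b' \<le> a'" by (auto simp: mult_le_cancel_left_pos)
  then show ?thesis by simp
qed

context join_semilattice_on begin

abbreviation le where "le \<equiv> join_le join"

lemma le_refl: "x \<in> L \<Longrightarrow> le x x"
  by (simp add: join_le_def idem)

lemma le_antisym: "x \<in> L \<Longrightarrow> y \<in> L \<Longrightarrow> le x y \<Longrightarrow> le y x \<Longrightarrow> x = y"
  by (metis commute join_le_def)

lemma le_trans: "x \<in> L \<Longrightarrow> y \<in> L \<Longrightarrow> z \<in> L \<Longrightarrow> le x y \<Longrightarrow> le y z \<Longrightarrow> le x z"
  by (metis assoc join_le_def)

lemma le_join: "x \<in> L \<Longrightarrow> y \<in> L \<Longrightarrow> le x (join x y)" "x \<in> L \<Longrightarrow> y \<in> L \<Longrightarrow> le y (join x y)"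
   apply (metis assoc idem join_le_def)
  by (metis assoc commute idem join_le_def closed)

lemma join_least: "x \<in> L \<Longrightarrow> y \<in> L \<Longrightarrow> z \<in> L \<Longrightarrow> le x z \<Longrightarrow> le y z \<Longrightarrow> le (join x y) z"
  by (metis assoc join_le_def)

lemma join_le_iff: "x \<in> L \<Longrightarrow> y \<in> L \<Longrightarrow> z \<in> L \<Longrightarrow> le (join x y) z \<longleftrightarrow> le x z \<and> le y z"
  by (meson le_join join_least le_trans closed)

text \<open>The dominance drawing. Rotating the coordinates \<open>(f, g)\<close> by 45 degrees makes the height \<open>f
  + g\<close> strictly monotone; the crossing argument compares points in the unrotated coordinates,
  where a point of an edge lies between its ends.\<close>

theorem planar_if_two_dimensional:
  fixes f g :: "'a \<Rightarrow> real"
  assumes dim: "\<And>x y. x \<in> L \<Longrightarrow> y \<in> L \<Longrightarrow> le x y \<longleftrightarrow> f x \<le> f y \<and> g x \<le> g y"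
  shows "planar_semilattice L join"
proof -
  define pos where "pos x = (f x - g x, f x + g x)" for x
  have dominated: "f x \<le> F \<and> F \<le> f y \<and> g x \<le> G \<and> G \<le> g y"
    if h: "p \<in> closed_segment (pos x) (pos y)" "x \<in> L" "y \<in> L" "le x y"
      "F = (snd p + fst p) / 2" "G = (snd p - fst p) / 2" for p x y F G
  proof -
    obtain t where t: "0 \<le> t" "t \<le> 1" "fst p = fst (pos x) + t * (fst (pos y) - fst (pos x))"
      "snd p = snd (pos x) + t * (snd (pos y) - snd (pos x))"
      using segment_coord[OF h(1)] by blast
    have F: "F = f x + t * (f y - f x)" and G: "G = g x + t * (g y - g x)"
      using h(5,6) t(3,4) by (auto simp: pos_def field_simps)
    have "f x \<le> f y" "g x \<le> g y" using dim h by auto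
    then have "0 \<le> t * (f y - f x)" "t * (f y - f x) \<le> f y - f x"
      "0 \<le> t * (g y - g x)" "t * (g y - g x) \<le> g y - g x"
      using t(1,2) by (auto simp: mult_left_le_one_le)
    then show ?thesis unfolding F G by linarith
  qed
  have pos_eq: "x = y" if "pos x = pos y" "x \<in> L" "y \<in> L" for x y
  proof -
    have "f x = f y" "g x = g y" using that(1) by (auto simp: pos_def)
    then show ?thesis using dim le_antisym that by auto
  qed
  have cov: "x \<in> L" "y \<in> L" "le x y" "x \<noteq> y" "\<And>z. z \<in> L \<Longrightarrow> le x z \<Longrightarrow> le z y \<Longrightarrow> z = x \<or> z = y"
    if "(x, y) \<in> coverings L le" for x y
    using that by (auto simp: coverings_def)
  have hasse: "hasse_diagram L le pos"
    unfolding hasse_diagram_def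
  proof
    show "inj_on pos L" by (auto intro!: inj_onI pos_eq)
    have "snd (pos x) < snd (pos y) \<and> (\<forall>z\<in>L. pos z \<in> closed_segment (pos x) (pos y) \<longrightarrow> z = x \<or> z =
      y)"
      if c: "(x, y) \<in> coverings L le" for x y
    proof
      note cov = cov[OF c]
      have "f x \<le> f y" "g x \<le> g y" using dim cov by auto
      moreover have "\<not> (f x = f y \<and> g x = g y)" using cov pos_eq[of x y] by (auto simp: pos_def)
      ultimately show "snd (pos x) < snd (pos y)" by (auto simp: pos_def)
      show "\<forall>z\<in>L. pos z \<in> closed_segment (pos x) (pos y) \<longrightarrow> z = x \<or> z = y"
      proof (intro ballI impI)
        fix z assume z: "z \<in> L" "pos z \<in> closed_segment (pos x) (pos y)"
        have "f x \<le> f z \<and> f z \<le> f y \<and> g x \<le> g z \<and> g z \<le> g y"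
          by (rule dominated[OF z(2)]) (use cov in \<open>auto simp: pos_def\<close>)
        then show "z = x \<or> z = y" using cov z dim by auto
      qed
    qed
    then show "\<forall>(x, y)\<in>coverings L le. snd (pos x) < snd (pos y) \<and>
        (\<forall>z\<in>L. pos z \<in> closed_segment (pos x) (pos y) \<longrightarrow> z = x \<or> z = y)" by blast
  qed
  have "crossing_free L le pos"
    unfolding crossing_free_def
  proof clarify
    fix x y u v p
    assume xy: "(x, y) \<in> coverings L le" and uv: "(u, v) \<in> coverings L le"
      and ne: "\<not> (x = u \<and> y = v)"
      and pxy: "p \<in> closed_segment (pos x) (pos y)" and puv: "p \<in> closed_segment (pos u) (pos v)"
    note X = cov[OF xy] and U = cov[OF uv]
    define F G where "F = (snd p + fst p) / 2" and "G = (snd p - fst p) / 2"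
    have FG: "p = (F - G, F + G)" by (simp add: F_def G_def prod_eq_iff field_simps)
    note d1 = dominated[OF pxy X(1,2,3) F_def G_def] and d2 = dominated[OF puv U(1,2,3) F_def G_def]
    have "le x v" "le u y" using d1 d2 dim[OF X(1) U(2)] dim[OF U(1) X(2)] by linarith+
    define w where "w = join x u"
    have w: "w \<in> L" "le x w" "le u w" "le w y" "le w v"
      using X(1-3) U(1-3) \<open>le x v\<close> \<open>le u y\<close> by (auto simp: w_def closed le_join join_least)
    have w1: "w = x \<or> w = y" and w2: "w = u \<or> w = v" using X(5)[of w] U(5)[of w] w by auto
    have apex: "p = pos z" if "F = f z" "G = g z" for z using that FG by (simp add: pos_def)
    obtain s where s: "0 \<le> s" "s \<le> 1" "fst p = fst (pos x) + s * (fst (pos y) - fst (pos x))"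
      "snd p = snd (pos x) + s * (snd (pos y) - snd (pos x))"
      using segment_coord[OF pxy] by blast
    obtain t where t: "0 \<le> t" "t \<le> 1" "fst p = fst (pos u) + t * (fst (pos v) - fst (pos u))"
      "snd p = snd (pos u) + t * (snd (pos v) - snd (pos u))"
      using segment_coord[OF puv] by blast
    have Fs: "F = f x + s * (f y - f x)" "G = g x + s * (g y - g x)"
      and Ft: "F = f u + t * (f v - f u)" "G = g u + t * (g v - g u)"
      unfolding F_def G_def using s t by (auto simp: pos_def field_simps)
    have mono: "f x \<le> f y" "g x \<le> g y" "f u \<le> f v" "g u \<le> g v"
      using dim[OF X(1,2)] dim[OF U(1,2)] X(3) U(3) by auto
    have ends: "f x \<noteq> f y \<or> g x \<noteq> g y" using X(1,2,4) pos_eq[of x y] by (auto simp: pos_def)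
    consider "w = x" "w = u" | "w = x" "w = v" | "w = y" "w = u" | "w = y" "w = v" using w1 w2
      by blast
    then show "p \<in> {pos x, pos y} \<inter> {pos u, pos v}"
    proof cases
      case 1
      then have "u = x" by simp
      have yv: "y \<noteq> v" using ne \<open>u = x\<close> by simp
      have eqs: "s * (f y - f x) = t * (f v - f x)" "s * (g y - g x) = t * (g v - g x)"
        using Fs Ft unfolding \<open>u = x\<close> by linarith+
      have "s = 0"
      proof (rule ccontr)
        assume "s \<noteq> 0"
        then have "f y - f x \<le> f v - f x \<and> g y - g x \<le> g v - g x \<or> f v - f x \<le> f y - f x \<and>
          g v - g x \<le> g y - g x"
          by (intro parallel_cases[OF eqs]) (use s t mono ends \<open>u = x\<close> in auto)
        then have "le y v \<or> le v y" using dim[OF X(2) U(2)] dim[OF U(2) X(2)] by linarith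
        then show False using X(5)[of v] U(5)[of y] X(1-4) U(1-4) yv \<open>u = x\<close> by auto
      qed
      then have "p = pos x" using Fs by (intro apex) simp_all
      then show ?thesis using \<open>u = x\<close> by simp
    next
      case 2
      have "F = f w" "G = g w" using d1 d2 unfolding 2(1)[symmetric] 2(2)[symmetric] by linarith+
      then have "p = pos w" by (rule apex)
      then show ?thesis using 2 by auto
    next
      case 3
      have "F = f w" "G = g w" using d1 d2 unfolding 3(1)[symmetric] 3(2)[symmetric] by linarith+
      then have "p = pos w" by (rule apex)
      then show ?thesis using 3 by auto
    next
      case 4
      then have "v = y" by simp
      have xu: "x \<noteq> u" using ne \<open>v = y\<close> by simp
      have eqs: "(1 - s) * (f y - f x) = (1 - t) * (f y - f u)"
        "(1 - s) * (g y - g x) = (1 - t) * (g y - g u)"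
        using Fs Ft unfolding \<open>v = y\<close> by (simp_all add: algebra_simps)
      have "s = 1"
      proof (rule ccontr)
        assume "s \<noteq> 1"
        then have "f y - f x \<le> f y - f u \<and> g y - g x \<le> g y - g u \<or> f y - f u \<le> f y - f x \<and>
          g y - g u \<le> g y - g x"
          by (intro parallel_cases[OF eqs]) (use s t mono ends \<open>v = y\<close> in auto)
        then have "le u x \<or> le x u" using dim[OF X(1) U(1)] dim[OF U(1) X(1)] by linarith
        then show False using X(5)[of u] U(5)[of x] X(1-4) U(1-4) xu \<open>v = y\<close> by auto
      qed
      then have "p = pos y" using Fs by (intro apex) simp_all
      then show ?thesis using \<open>v = y\<close> by simp
    qed
  qed
  with hasse show ?thesis unfolding planar_semilattice_def planar_poset_def by blast
qed

end

section \<open>The Boolean lattice with three atoms\<close>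

text \<open>The abscissa, at height \<open>y\<close>, of the line through \<open>p\<close> and \<open>q\<close>.\<close>

definition line :: "real \<times> real \<Rightarrow> real \<times> real \<Rightarrow> real \<Rightarrow> real" where
  "line p q y = fst p + (y - snd p) * ((fst q - fst p) / (snd q - snd p))"

lemma line_in_segment:
  assumes "snd p < snd q" "snd p \<le> y" "y \<le> snd q"
  shows "(line p q y, y) \<in> closed_segment p q"
proof -
  define s where "s = (y - snd p) / (snd q - snd p)"
  have "0 \<le> s" "s \<le> 1" using assms by (auto simp: s_def)
  moreover have "line p q y = (1 - s) * fst p + s * fst q"
    by (simp add: line_def s_def algebra_simps diff_divide_distrib)
  moreover have "s * (snd q - snd p) = y - snd p" using assms by (simp add: s_def)
  then have "y = (1 - s) * snd p + s * snd q" by (simp add: algebra_simps)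
  ultimately have "0 \<le> s" "s \<le> 1" "(line p q y, y) = (1 - s) *\<^sub>R p + s *\<^sub>R q"
    by (simp_all add: prod_eq_iff)
  then show ?thesis by (auto simp: in_segment)
qed

lemma line_ends: "snd p < snd q \<Longrightarrow> line p q (snd q) = fst q" "line p q (snd p) = fst p"
  by (auto simp: line_def)

lemma continuous_line: "continuous_on A f \<Longrightarrow> continuous_on A (\<lambda>y. line p q (f y))"
  unfolding line_def by (intro continuous_intros)

lemma same_side:
  fixes \<phi> \<psi> :: "real \<Rightarrow> real"
  assumes cont: "continuous_on {a..b} \<phi>" "continuous_on {a..b} \<psi>" and ab: "a \<le> b"
    and ne: "\<And>y. a \<le> y \<Longrightarrow> y \<le> b \<Longrightarrow> \<phi> y \<noteq> \<psi> y" and less: "\<phi> a < \<psi> a"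
  shows "\<phi> b < \<psi> b"
proof (rule ccontr)
  assume "\<not> \<phi> b < \<psi> b"
  then have "\<exists>y\<ge>a. y \<le> b \<and> \<psi> y - \<phi> y = 0"
    using ab less by (intro IVT2') (auto intro!: continuous_intros cont)
  then show False using ne by force
qed

text \<open>Upward chains are graphs of continuous functions of the height. Near \<open>p\<close> the inner chain
  \<open>p, b, n, t\<close> runs between the outer chains \<open>p, a, m\<close> and \<open>p, c, m\<close>, and without meeting them it
  stays strictly between them, which is impossible at the height of \<open>m\<close>, where the outer chains
  come together.\<close>

lemma no_trapped_chain:
  fixes p a b c m n t :: "real \<times> real"
  assumes up: "snd p < snd a" "snd p < snd b" "snd p < snd c" "snd a < snd m" "snd c < snd m"
      "snd b < snd n" "snd n < snd t" "snd m < snd t"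
    and slopes: "(fst a - fst p) / (snd a - snd p) < (fst b - fst p) / (snd b - snd p)"
      "(fst b - fst p) / (snd b - snd p) < (fst c - fst p) / (snd c - snd p)"
    and disj: "\<And>u v x y. (u, v) \<in> {(p, b), (b, n), (n, t)} \<Longrightarrow>
      (x, y) \<in> {(p, a), (a, m), (p, c), (c, m)} \<Longrightarrow>
      closed_segment u v \<inter> closed_segment x y \<subseteq> {p}"
  shows False
proof -
  define outer where "outer a y = line p a (min y (snd a)) + line a m (max y (snd a)) - fst a"
    for a y
  define inner where
    "inner y = line p b (min y (snd b)) + (line b n (max (snd b) (min y (snd n))) - fst b)
    + (line n t (max y (snd n)) - fst n)" for y
  \<comment> \<open>up to the height \<open>y0\<close>, each chain is still on its first edge, so the slopes decide\<close>
  define y0 where "y0 = Min {snd a, snd b, snd c, snd m}"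
  have y0: "snd p < y0" "y0 \<le> snd a" "y0 \<le> snd b" "y0 \<le> snd c" "y0 \<le> snd m"
    unfolding y0_def using up by auto
  have outer_on: "\<exists>u v. (u, v) \<in> {(p, a), (a, m)} \<and> (outer a y, y) \<in> closed_segment u v"
    if "snd p < snd a" "snd a < snd m" "snd p \<le> y" "y \<le> snd m" for a y
  proof (cases "y \<le> snd a")
    case True
    then show ?thesis using that
      by (intro exI[of _ p] exI[of _ a]) (simp add: outer_def line_ends line_in_segment)
  next
    case False
    then show ?thesis using that
      by (intro exI[of _ a] exI[of _ m]) (simp add: outer_def line_ends line_in_segment)
  qed
  have inner_on: "\<exists>u v. (u, v) \<in> {(p, b), (b, n), (n, t)} \<and> (inner y, y) \<in> closed_segment u v"
    if "snd p \<le> y" "y \<le> snd m" for y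
  proof -
    consider "y \<le> snd b" | "snd b < y" "y \<le> snd n" | "snd n < y" by linarith
    then show ?thesis
    proof cases
      case 1
      then show ?thesis using that up
        by (intro exI[of _ p] exI[of _ b]) (simp add: inner_def line_ends line_in_segment)
    next
      case 2
      then show ?thesis using that up
        by (intro exI[of _ b] exI[of _ n]) (simp add: inner_def line_ends line_in_segment)
    next
      case 3
      then show ?thesis using that up
        by (intro exI[of _ n] exI[of _ t]) (simp add: inner_def line_ends line_in_segment)
    qed
  qed
  have cont: "continuous_on {y0..snd m} (outer a)" "continuous_on {y0..snd m} inner" for a
    unfolding outer_def inner_def by (intro continuous_intros continuous_line)+
  have avoid: "outer d y \<noteq> inner y" if h: "d = a \<or> d = c" "y0 \<le> y" "y \<le> snd m" for d y
  proof
    assume eq: "outer d y = inner y"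
    have y: "snd p < y" using y0 h by simp
    obtain u v where uv: "(u, v) \<in> {(p, b), (b, n), (n, t)}" "(inner y, y) \<in> closed_segment u v"
      using inner_on[OF less_imp_le[OF y] h(3)] by blast
    obtain x z where xz: "(x, z) \<in> {(p, d), (d, m)}" "(outer d y, y) \<in> closed_segment x z"
      using outer_on[OF _ _ less_imp_le[OF y] h(3), of d] h(1) up by blast
    have "(inner y, y) \<in> {p}" using disj[OF uv(1), of x z] uv xz eq h by auto
    then show False using y by auto
  qed
  have at_y0: "outer d y0 = line p d y0" "inner y0 = line p b y0" if "y0 \<le> snd d" "snd d < snd m"
    for d
    using that y0 up by (auto simp: outer_def inner_def line_ends)
  have "outer a y0 < inner y0" "inner y0 < outer c y0"
    using at_y0[of a] at_y0[of c] y0 up mult_strict_left_mono[OF slopes(1), of "y0 - snd p"]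
      mult_strict_left_mono[OF slopes(2), of "y0 - snd p"] by (simp_all add: line_def)
  then have "outer a (snd m) < inner (snd m)" "inner (snd m) < outer c (snd m)"
    using same_side[OF cont(1)[of a] cont(2)] same_side[OF cont(2) cont(1)[of c]] avoid y0 by metis+
  moreover have "outer d (snd m) = fst m" if "snd p < snd d" "snd d < snd m" for d
    using that by (simp add: outer_def line_ends)
  ultimately show False using up by auto
qed

lemma A0_covering: "S \<subseteq> {0, 1, 2} \<Longrightarrow> i \<in> {0, 1, 2} \<Longrightarrow> i \<notin> S \<Longrightarrow>
  (S, insert i S) \<in> coverings A0 (join_le (\<union>))"
proof -
  assume S: "S \<subseteq> {0, 1, 2}" "i \<in> {0, 1, 2}" "i \<notin> S"
  have le: "join_le (\<union>) X Y \<longleftrightarrow> X \<subseteq> Y" for X Y :: "nat set" by (auto simp: join_le_def)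
  have "z = S \<or> z = insert i S" if "S \<subseteq> z" "z \<subseteq> insert i S" for z using that by blast
  then show ?thesis using S unfolding coverings_def A0_def le by blast
qed

lemma A0_not_planar: "\<not> planar_semilattice A0 (\<union>)"
proof
  assume "planar_semilattice A0 (\<union>)"
  then obtain pos where h: "hasse_diagram A0 (join_le (\<union>)) pos"
    and c: "crossing_free A0 (join_le (\<union>)) pos"
    unfolding planar_semilattice_def planar_poset_def by blast
  let ?E = "coverings A0 (join_le (\<union>))"
  define p where "p = pos {}"
  have inj: "pos S = pos T \<longleftrightarrow> S = T" if "S \<subseteq> {0, 1, 2}" "T \<subseteq> {0, 1, 2}" for S T
    using h that by (auto simp: hasse_diagram_def A0_def dest: inj_onD)
  have up: "snd (pos S) < snd (pos T)" if "(S, T) \<in> ?E" for S T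
    using h that unfolding hasse_diagram_def by blast
  have meet: "closed_segment (pos S) (pos T) \<inter> closed_segment (pos U) (pos V) \<subseteq> {pos S,
    pos T} \<inter> {pos U, pos V}"
    if "(S, T) \<in> ?E" "(U, V) \<in> ?E" "(S, T) \<noteq> (U, V)" for S T U V
    using c that unfolding crossing_free_def by fastforce
  define slope where "slope i = (fst (pos {i}) - fst p) / (snd (pos {i}) - snd p)" for i :: nat
  have E1: "({}, {i}) \<in> ?E" if "i \<in> {0, 1, 2}" for i
    using A0_covering[of "{}" i] that by simp
  have E2: "({i}, {i, j}) \<in> ?E" if "i \<in> {0, 1, 2}" "j \<in> {0, 1, 2}" "i \<noteq> j" for i j
    using A0_covering[of "{i}" j] that insert_commute[of j i "{}"] by simp
  have E3: "({i, j}, {i, j, k}) \<in> ?E" if "i \<in> {0, 1, 2}" "j \<in> {0, 1, 2}" "k \<in> {0, 1, 2}" "k \<noteq> i"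
    "k \<noteq> j" for i j k
  proof -
    have "{i, j, k} = insert k {i, j}" by auto
    then show ?thesis using A0_covering[of "{i, j}" k] that by simp
  qed
  have distinct: "slope i \<noteq> slope j" if ij: "i \<in> {0, 1, 2}" "j \<in> {0, 1, 2}" "i \<noteq> j" for i j
  proof
    assume eq: "slope i = slope j"
    define y where "y = min (snd (pos {i})) (snd (pos {j}))"
    have y: "snd p < y" "y \<le> snd (pos {i})" "y \<le> snd (pos {j})"
      using up[OF E1[OF ij(1)]] up[OF E1[OF ij(2)]] by (auto simp: y_def p_def)
    have "line p (pos {i}) y = line p (pos {j}) y" using eq by (simp add: line_def slope_def)
    then have
      "(line p (pos {i}) y, y) \<in> closed_segment (pos {}) (pos {i}) \<inter> closed_segment (pos {}) (pos
        {j})"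
      using line_in_segment[of p "pos {i}" y] line_in_segment[of p "pos {j}" y] y
        by (auto simp: p_def)
    then have "(line p (pos {i}) y, y) \<in> {pos {}, pos {i}} \<inter> {pos {}, pos {j}}"
      using meet[OF E1[OF ij(1)] E1[OF ij(2)]] ij by blast
    moreover have "pos {i} \<noteq> pos {j}" "pos {i} \<noteq> pos {}" "pos {j} \<noteq> pos {}"
      using ij inj[of "{i}" "{j}"] inj[of "{i}" "{}"] inj[of "{j}" "{}"] by simp_all
    ultimately have "(line p (pos {i}) y, y) = p" unfolding p_def by auto
    then have "y = snd p" by (metis snd_conv)
    then show False using y by simp
  qed
  have trap: False if ijk: "i \<in> {0, 1, 2}" "j \<in> {0, 1, 2}" "k \<in> {0, 1, 2}" "slope i < slope j"
    "slope j < slope k" for i j k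
  proof (rule no_trapped_chain[of p "pos {i}" "pos {j}" "pos {k}" "pos {i, k}" "pos {j, i}"
    "pos {i, j, k}"])
    have ne: "i \<noteq> j" "j \<noteq> k" "i \<noteq> k" using ijk by auto
    have sets: "{k, i} = {i, k}" "{j, i, k} = {i, j, k}" "{i, k, j} = {i, j, k}" by auto
    have edges: "({}, {i}) \<in> ?E" "({}, {j}) \<in> ?E" "({}, {k}) \<in> ?E" "({i}, {i, k}) \<in> ?E"
      "({k}, {i, k}) \<in> ?E"
      "({j}, {j, i}) \<in> ?E" "({j, i}, {i, j, k}) \<in> ?E" "({i, k}, {i, j, k}) \<in> ?E"
      using E1[OF ijk(1)] E1[OF ijk(2)] E1[OF ijk(3)] E2[OF ijk(1,3) ne(3)] E2[OF ijk(3,1)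
        ne(3)[symmetric]]
        E2[OF ijk(2,1) ne(1)[symmetric]] E3[OF ijk(2,1,3) ne(2)[symmetric] ne(3)[symmetric]]
        E3[OF ijk(1,3,2) ne(1)[symmetric] ne(2)] unfolding sets by - (assumption)+
    show "snd p < snd (pos {i})" "snd p < snd (pos {j})" "snd p < snd (pos {k})"
      "snd (pos {i}) < snd (pos {i, k})"
      "snd (pos {k}) < snd (pos {i, k})" "snd (pos {j}) < snd (pos {j, i})"
        "snd (pos {j, i}) < snd (pos {i, j, k})"
      "snd (pos {i, k}) < snd (pos {i, j, k})"
      using edges[THEN up] unfolding p_def by - (assumption)+
    show "(fst (pos {i}) - fst p) / (snd (pos {i}) - snd p) < (fst (pos {j}) - fst p) / (snd (pos
      {j}) - snd p)"
      "(fst (pos {j}) - fst p) / (snd (pos {j}) - snd p) < (fst (pos {k}) - fst p) / (snd (pos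
        {k}) - snd p)"
      using ijk(4,5) by (auto simp: slope_def)
    have disj: "closed_segment (pos S) (pos T) \<inter> closed_segment (pos U) (pos V) \<subseteq> {p}"
      if ST: "(S, T) \<in> {({}, {j}), ({j}, {j, i}), ({j, i}, {i, j, k})}"
        and UV: "(U, V) \<in> {({}, {i}), ({i}, {i, k}), ({}, {k}), ({k}, {i, k})}" for S T U V
    proof -
      have E: "(S, T) \<in> ?E" using ST edges by blast
      have E': "(U, V) \<in> ?E" using UV edges by blast
      have "j \<in> T" using ST by auto
      moreover have "j \<notin> V" using UV ne by auto
      ultimately have neq: "(S, T) \<noteq> (U, V)" by auto
      have "S = {} \<or> j \<in> S" using ST by auto
      moreover have "j \<notin> U" using UV ne by auto
      ultimately have "{S, T} \<inter> {U, V} \<subseteq> {{}}" using \<open>j \<in> T\<close> \<open>j \<notin> V\<close> by blast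
      moreover have "{S, T} \<subseteq> A0" "{U, V} \<subseteq> A0" using E E' by (simp_all add: coverings_def)
      moreover have "inj_on pos A0" using h by (simp add: hasse_diagram_def)
      ultimately have "pos ` {S, T} \<inter> pos ` {U, V} \<subseteq> pos ` {{}}"
        by (metis image_mono inj_on_image_Int)
      then have "{pos S, pos T} \<inter> {pos U, pos V} \<subseteq> {p}" by (simp add: p_def)
      then show ?thesis using meet[OF E E' neq] by blast
    qed
    fix u v x y
    assume "(u, v) \<in> {(p, pos {j}), (pos {j}, pos {j, i}), (pos {j, i}, pos {i, j, k})}"
      and "(x, y) \<in> {(p, pos {i}), (pos {i}, pos {i, k}), (p, pos {k}), (pos {k}, pos {i, k})}"
    then have "\<exists>e\<in>{({}, {j}), ({j}, {j, i}), ({j, i}, {i, j, k})}. u = pos (fst e) \<and> v =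
      pos (snd e)"
      "\<exists>e\<in>{({}, {i}), ({i}, {i, k}), ({}, {k}), ({k}, {i, k})}. x = pos (fst e) \<and> y = pos (snd e)"
      by (simp_all add: p_def)
    then show "closed_segment u v \<inter> closed_segment x y \<subseteq> {p}"
      using disj by (metis prod.collapse)
  qed
  have "slope 0 \<noteq> slope 1" "slope 0 \<noteq> slope 2" "slope 1 \<noteq> slope 2" by (rule distinct; simp)+
  then consider "slope 0 < slope 1" "slope 1 < slope 2" | "slope 0 < slope 2" "slope 2 < slope 1"
    | "slope 1 < slope 0" "slope 0 < slope 2" | "slope 1 < slope 2" "slope 2 < slope 0"
    | "slope 2 < slope 0" "slope 0 < slope 1" | "slope 2 < slope 1" "slope 1 < slope 0"
    by linarith
  then show False by cases (rule trap; simp; fail)+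
qed

section \<open>Drawings with integer coordinates\<close>

text \<open>Twice the signed area of the triangle \<open>p q r\<close>; it vanishes for collinear points.\<close>

definition orient :: "int \<times> int \<Rightarrow> int \<times> int \<Rightarrow> int \<times> int \<Rightarrow> int" where
  "orient p q r = (fst q - fst p) * (snd r - snd p) - (snd q - snd p) * (fst r - fst p)"

text \<open>A test that is sufficient, though not necessary: segments with a common end must have
  different directions, and of two other segments one must lie strictly on one side of the line
  through the other.\<close>

definition noncrossing :: "int \<times> int \<Rightarrow> int \<times> int \<Rightarrow> int \<times> int \<Rightarrow> int \<times> int \<Rightarrow> bool" where
  "noncrossing p q r s =
    (if p = r \<or> q = r then orient p q s \<noteq> 0
     else if p = s \<or> q = s then orient p q r \<noteq> 0
     else 0 < orient p q r * orient p q s \<or> 0 < orient r s p * orient r s q)"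

definition real_point :: "int \<times> int \<Rightarrow> real \<times> real" where
  "real_point p = (real_of_int (fst p), real_of_int (snd p))"

lemma real_point_inject [simp]: "real_point p = real_point q \<longleftrightarrow> p = q"
  by (simp add: real_point_def prod_eq_iff)

definition ori :: "real \<times> real \<Rightarrow> real \<times> real \<Rightarrow> real \<times> real \<Rightarrow> real" where
  "ori p q r = (fst q - fst p) * (snd r - snd p) - (snd q - snd p) * (fst r - fst p)"

lemma ori_real_point: "ori (real_point p) (real_point q) (real_point r) =
  real_of_int (orient p q r)"
  by (simp add: ori_def orient_def real_point_def)

lemma ori_on_segment:
  assumes "x \<in> closed_segment r s"
  shows "\<exists>t. 0 \<le> t \<and> t \<le> 1 \<and> x = (1 - t) *\<^sub>R r + t *\<^sub>R s \<and> ori p q x =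
    (1 - t) * ori p q r + t * ori p q s"
proof -
  obtain t where t: "0 \<le> t" "t \<le> 1" "x = (1 - t) *\<^sub>R r + t *\<^sub>R s"
    using assms by (auto simp: in_segment)
  have "ori p q x = (1 - t) * ori p q r + t * ori p q s"
    unfolding t(3) by (simp add: ori_def algebra_simps)
  with t show ?thesis by blast
qed

lemma ori_zero: "x \<in> closed_segment p q \<Longrightarrow> ori p q x = 0"
  using ori_on_segment[of x p q p q] by (auto simp: ori_def)

lemma segments_apart:
  assumes "0 < ori p q r * ori p q s"
  shows "closed_segment p q \<inter> closed_segment r s = {}"
proof (rule equals0I)
  fix x assume x: "x \<in> closed_segment p q \<inter> closed_segment r s"
  obtain t where t: "0 \<le> t" "t \<le> 1" "ori p q x = (1 - t) * ori p q r + t * ori p q s"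
    using ori_on_segment[of x r s p q] x by auto
  have z: "(1 - t) * ori p q r + t * ori p q s = 0" using t ori_zero x by auto
  consider "0 < ori p q r" "0 < ori p q s" | "ori p q r < 0" "ori p q s < 0"
    using assms by (auto simp: zero_less_mult_iff)
  then show False
  proof cases
    case 1
    then show ?thesis using z t by (smt (verit) mult_nonneg_nonneg mult_pos_pos)
  next
    case 2
    then show ?thesis using z t by (smt (verit) mult_nonneg_nonpos mult_pos_neg)
  qed
qed

lemma segments_fan:
  assumes "ori p q s \<noteq> 0"
  shows "closed_segment p q \<inter> closed_segment p s \<subseteq> {p}"
    "closed_segment p q \<inter> closed_segment q s \<subseteq> {q}"
proof -
  have pp: "ori p q p = 0" "ori p q q = 0" by (auto simp: ori_def)
  have "x = r" if "ori p q r = 0" "x \<in> closed_segment p q" "x \<in> closed_segment r s" for x r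
    using ori_on_segment[OF that(3), of p q] ori_zero[OF that(2)] that(1) assms by auto
  then show "closed_segment p q \<inter> closed_segment p s \<subseteq> {p}"
    "closed_segment p q \<inter> closed_segment q s \<subseteq> {q}"
    using pp by blast+
qed

lemma noncrossing:
  assumes "noncrossing p q r s"
  shows "closed_segment (real_point p) (real_point q) \<inter> closed_segment (real_point r) (real_point s)
    \<subseteq> {real_point p, real_point q} \<inter> {real_point r, real_point s}"
proof -
  let ?p = "real_point p" and ?q = "real_point q" and ?r = "real_point r" and ?s = "real_point s"
  consider "p = r \<or> q = r" "orient p q s \<noteq> 0" | "p = s \<or> q = s" "orient p q r \<noteq> 0"
    | "0 < orient p q r * orient p q s" | "0 < orient r s p * orient r s q"
    using assms unfolding noncrossing_def by (auto split: if_splits)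
  then show ?thesis
  proof cases
    case 1
    then have "ori ?p ?q ?s \<noteq> 0" by (simp add: ori_real_point)
    then show ?thesis using 1(1) segments_fan[of ?p ?q ?s] by auto
  next
    case 2
    then have "ori ?p ?q ?r \<noteq> 0" by (simp add: ori_real_point)
    then show ?thesis using 2(1) segments_fan[of ?p ?q ?r]
      by (auto simp: closed_segment_commute[of ?r])
  next
    case 3
    then have "0 < ori ?p ?q ?r * ori ?p ?q ?s" by (simp add: ori_real_point flip: of_int_mult)
    then show ?thesis using segments_apart by blast
  next
    case 4
    then have "0 < ori ?r ?s ?p * ori ?r ?s ?q" by (simp add: ori_real_point flip: of_int_mult)
    then show ?thesis using segments_apart by blast
  qed
qed

lemma planar_poset_by_drawing:
  fixes loc :: "'a \<Rightarrow> int \<times> int"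
  assumes inj: "inj_on loc P"
    and edge: "\<And>x y z. (x, y) \<in> coverings P le \<Longrightarrow> z \<in> P \<Longrightarrow>
      snd (loc x) < snd (loc y) \<and> (z = x \<or> z = y \<or> orient (loc x) (loc y) (loc z) \<noteq> 0)"
    and edges: "\<And>x y u v. (x, y) \<in> coverings P le \<Longrightarrow> (u, v) \<in> coverings P le \<Longrightarrow>
      (x = u \<and> y = v) \<or> noncrossing (loc x) (loc y) (loc u) (loc v)"
  shows "planar_poset P le"
proof -
  have P: "x \<in> P" if "(x, y) \<in> coverings P le" for x y using that by (auto simp: coverings_def)
  have "hasse_diagram P le (real_point \<circ> loc)"
    unfolding hasse_diagram_def
  proof
    show "inj_on (real_point \<circ> loc) P" using inj by (auto simp: inj_on_def)
    have "snd (real_point (loc x)) < snd (real_point (loc y)) \<and>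
        (\<forall>z\<in>P. real_point (loc z) \<in> closed_segment (real_point (loc x)) (real_point (loc y)) \<longrightarrow> z =
          x \<or> z = y)"
      if "(x, y) \<in> coverings P le" for x y
    proof (intro conjI ballI impI)
      show "snd (real_point (loc x)) < snd (real_point (loc y))"
        using edge[OF that P[OF that]] by (simp add: real_point_def)
      fix z assume "z \<in> P"
        and z: "real_point (loc z) \<in> closed_segment (real_point (loc x)) (real_point (loc y))"
      have "orient (loc x) (loc y) (loc z) = 0" using ori_zero[OF z] by (simp add: ori_real_point)
      then show "z = x \<or> z = y" using edge[OF that \<open>z \<in> P\<close>] by blast
    qed
    then show "\<forall>(x, y)\<in>coverings P le. snd ((real_point \<circ> loc) x) < snd ((real_point \<circ> loc) y) \<and>
        (\<forall>z\<in>P. (real_point \<circ> loc) z \<in> closed_segment ((real_point \<circ> loc) x) ((real_point \<circ> loc) y)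
          \<longrightarrow> z = x \<or> z = y)"
      by fastforce
  qed
  moreover have "crossing_free P le (real_point \<circ> loc)"
    unfolding crossing_free_def
  proof (clarify)
    fix x y u v r
    assume "(x, y) \<in> coverings P le" "(u, v) \<in> coverings P le" "\<not> (x = u \<and> y = v)"
      and "r \<in> closed_segment ((real_point \<circ> loc) x) ((real_point \<circ> loc) y)"
        "r \<in> closed_segment ((real_point \<circ> loc) u) ((real_point \<circ> loc) v)"
    then show "r \<in> {(real_point \<circ> loc) x, (real_point \<circ> loc) y} \<inter> {(real_point \<circ> loc) u,
      (real_point \<circ> loc) v}"
      using noncrossing[of "loc x" "loc y" "loc u" "loc v"] edges[of x y u v] by auto
  qed
  ultimately show ?thesis unfolding planar_poset_def by blast
qed

section \<open>Semilattices as bit matrices\<close>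

type_synonym mask = "bool list"

fun incl :: "mask \<Rightarrow> mask \<Rightarrow> bool" where
  "incl (a # r) (b # v) = (if a then (if b then incl r v else False) else incl r v)"
| "incl _ _ = True"

fun mask_inter :: "mask \<Rightarrow> mask \<Rightarrow> mask" where
  "mask_inter (a # r) (b # v) = (a \<and> b) # mask_inter r v"
| "mask_inter _ _ = []"

fun mask_union :: "mask \<Rightarrow> mask \<Rightarrow> mask" where
  "mask_union (a # r) (b # v) = (a \<or> b) # mask_union r v"
| "mask_union _ _ = []"

fun same :: "mask \<Rightarrow> mask \<Rightarrow> bool" where
  "same (a # r) (b # v) = (if a then (if b then same r v else False) else (if b then False else
    same r v))"
| "same [] [] = True"
| "same [] (b # v) = False"
| "same (a # r) [] = False"

fun lexle :: "mask \<Rightarrow> mask \<Rightarrow> bool" where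
  "lexle (a # r) (b # v) =
    (if a then (if b then lexle r v else False) else (if b then True else lexle r v))"
| "lexle _ _ = True"

lemma same_iff: "same r v \<longleftrightarrow> r = v"
  by (induction r v rule: same.induct) auto

lemma length_mask_inter [simp]: "length r = length v \<Longrightarrow> length (mask_inter r v) = length r"
  by (induction r v rule: mask_inter.induct) auto

lemma incl_map: "incl (map P xs) (map Q xs) \<longleftrightarrow> (\<forall>x\<in>set xs. P x \<longrightarrow> Q x)"
  by (induction xs) auto

lemma mask_inter_map: "mask_inter (map P xs) (map Q xs) = map (\<lambda>x. P x \<and> Q x) xs"
  by (induction xs) auto

lemma mask_union_map: "mask_union (map P xs) (map Q xs) = map (\<lambda>x. P x \<or> Q x) xs"
  by (induction xs) auto

lemma incl_refl [simp]: "incl r r"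
  by (induction r) auto

lemma incl_trans: "incl r v \<Longrightarrow> incl v w \<Longrightarrow> length r = length v \<Longrightarrow> length v = length w \<Longrightarrow> incl r w"
proof (induction r v arbitrary: w rule: incl.induct)
  case (1 a r b v)
  then obtain c w' where "w = c # w'" by (cases w) auto
  then show ?case using 1 by (auto split: if_splits)
qed auto

lemma incl_mask_inter:
  "length r = length v \<Longrightarrow> length v = length w \<Longrightarrow> incl w (mask_inter r v) \<longleftrightarrow> incl w r \<and> incl w v"
proof (induction r v arbitrary: w rule: mask_inter.induct)
  case (1 a r b v)
  then obtain c w' where "w = c # w'" by (cases w) auto
  then show ?case using 1 by auto
qed auto

text \<open>The number with the given binary digits. It allows choosing a lexicographically least mask
  by minimizing a natural number.\<close>

fun rank :: "mask \<Rightarrow> nat" where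
  "rank [] = 0"
| "rank (b # r) = (if b then 2 ^ length r else 0) + rank r"

lemma rank_less: "rank r < 2 ^ length r"
  by (induction r) auto

lemma lexle_iff_rank: "length r = length v \<Longrightarrow> lexle r v \<longleftrightarrow> rank r \<le> rank v"
proof (induction r v rule: lexle.induct)
  case (1 a r b v)
  then show ?case using rank_less[of r] rank_less[of v] by auto
qed auto

lemma incl_rank: "length r = length v \<Longrightarrow> incl r v \<Longrightarrow> rank r \<le> rank v"
  by (induction r v rule: incl.induct) (auto split: if_splits)

text \<open>In a matrix, the newest element comes first, and its row marks its strict upper bounds
  among the older ones. A set of elements is a principal filter exactly if everything after its
  first (that is, lowest) member is marked as in the row of that member.\<close>

fun principal :: "mask \<Rightarrow> mask list \<Rightarrow> bool" where
  "principal (b # w) (r # t) = (if b then same w r else principal w t)"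
| "principal _ _ = False"

fun extend_rows :: "mask \<Rightarrow> mask list \<Rightarrow> mask list \<Rightarrow> mask list" where
  "extend_rows r t [] = []"
| "extend_rows r t (V # Vs) =
    (if incl r V then (\<lambda>l. (True # V) # l) else (\<lambda>l. l))
     ((if principal (mask_inter V r) t then (\<lambda>l. (False # V) # l) else (\<lambda>l. l)) (extend_rows r t
       Vs))"

text \<open>The rows that a new minimal element \<open>x\<close> may have: compared with an old element \<open>e\<close> with
  row \<open>r\<close>, either \<open>x < e\<close>, and then \<open>x\<close> is below all upper bounds of \<open>e\<close>, or \<open>x\<close> and \<open>e\<close> are
  incomparable, and then their common upper bounds must be the principal filter of the join.\<close>

fun new_rows :: "mask list \<Rightarrow> mask list" where
  "new_rows [] = [[]]"
| "new_rows (r # t) = extend_rows r t (new_rows t)"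

fun after :: "mask \<Rightarrow> mask list \<Rightarrow> bool" where
  "after U [] = True"
| "after U (V # t) = lexle (False # V) U"

fun zeros :: "mask list \<Rightarrow> mask" where
  "zeros [] = []"
| "zeros (r # t) = False # zeros t"

text \<open>The mask \<open>d # D\<close> marks the elements that have a lower bound among the elements already
  passed. An unmarked element is minimal, and it has just one upper cover if and only if its row
  is a principal filter.\<close>

fun pendant_free :: "mask \<Rightarrow> mask list \<Rightarrow> bool" where
  "pendant_free (d # D) (r # t) =
    (if d then pendant_free (mask_union D r) t
     else if principal r t then False else pendant_free (mask_union D r) t)"
| "pendant_free _ _ = True"

text \<open>The rows of the reflexive order, padded to the full size. Row inclusion is the reverse
  order and row intersection is the join, so the full rows form a copy of the semilattice.\<close>

fun full_rows :: "mask list \<Rightarrow> mask list" where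
  "full_rows [] = []"
| "full_rows (r # t) = (True # r) # map (Cons False) (full_rows t)"

lemma set_extend_rows:
  "set (extend_rows r t Vs) =
    {True # V |V. V \<in> set Vs \<and> incl r V} \<union> {False # V |V. V \<in> set Vs \<and>
      principal (mask_inter V r) t}"
  by (induction Vs) auto

fun up_rows :: "('a \<Rightarrow> 'a \<Rightarrow> bool) \<Rightarrow> 'a list \<Rightarrow> mask list" where
  "up_rows lt [] = []"
| "up_rows lt (x # ds) = map (lt x) ds # up_rows lt ds"

lemma length_up_rows [simp]: "length (up_rows lt ds) = length ds"
  by (induction ds) auto

lemma zeros_up_rows: "zeros (up_rows lt ds) = map (\<lambda>_. False) ds"
  by (induction ds) auto

context join_semilattice_on begin

definition lt :: "'a \<Rightarrow> 'a \<Rightarrow> bool" where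
  "lt x y \<longleftrightarrow> x \<noteq> y \<and> le x y"

lemma lt_trans: "x \<in> L \<Longrightarrow> y \<in> L \<Longrightarrow> z \<in> L \<Longrightarrow> lt x y \<Longrightarrow> lt y z \<Longrightarrow> lt x z"
  unfolding lt_def using le_trans[of x y z] le_antisym[of x y] by blast

lemma lt_irrefl [simp]: "\<not> lt x x"
  by (simp add: lt_def)

text \<open>Each element is listed after its upper bounds, at the front. The condition \<open>after\<close> asks
  the rows to increase lexicographically; the row of the preceding element is padded with
  \<open>False\<close>, as no element is strictly below itself.\<close>

primrec listing :: "'a list \<Rightarrow> bool" where
  "listing [] \<longleftrightarrow> True"
| "listing (x # ds) \<longleftrightarrow> x \<in> L \<and> x \<notin> set ds \<and> (\<forall>y\<in>L. lt x y \<longrightarrow> y \<in> set ds) \<and>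
    after (map (lt x) ds) (up_rows lt ds) \<and> listing ds"

lemma listing_subset: "listing ds \<Longrightarrow> set ds \<subseteq> L"
  by (induction ds) auto

lemma listing_distinct: "listing ds \<Longrightarrow> distinct ds"
  by (induction ds) auto

lemma listing_up: "listing ds \<Longrightarrow> x \<in> set ds \<Longrightarrow> y \<in> L \<Longrightarrow> lt x y \<Longrightarrow> y \<in> set ds"
  by (induction ds) auto

lemma listing_append: "listing (es @ ds) \<Longrightarrow> listing ds"
  by (induction es) auto

text \<open>The listing is built greedily. Next comes, of the remaining elements whose rows (over the
  elements listed so far) have least rank, a maximal one; an upper bound has a row included in
  that of the element and hence no larger rank, so no remaining element is above the chosen one.
  The row of any other remaining element is not smaller, and stays so when the bit for the chosen
  element is prepended.\<close>

lemma ex_listing: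
  assumes fin: "finite L"
  shows "\<exists>ds. listing ds \<and> set ds = L"
proof -
  have "\<exists>ds. listing ds \<and> length ds = k \<and> (\<forall>z\<in>L - set ds. after (map (lt z) ds) (up_rows lt ds))"
    if "k \<le> card L" for k
    using that
  proof (induction k)
    case 0
    show ?case by (intro exI[of _ "[]"]) simp
  next
    case (Suc k)
    then obtain ds where ds: "listing ds" "length ds = k"
      and next_ok: "\<And>z. z \<in> L - set ds \<Longrightarrow> after (map (lt z) ds) (up_rows lt ds)" by auto
    define R where "R = L - set ds"
    define key where "key x = rank (map (lt x) ds)" for x
    define A where "A = {x \<in> R. \<forall>z\<in>R. key x \<le> key z}"
    have "card (set ds) = k" using ds listing_distinct distinct_card by blast
    then have "R \<noteq> {}" using Suc.prems card_mono[of "set ds" L] unfolding R_def by auto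
    then have "\<exists>x. x \<in> R \<and> (\<forall>z. z \<in> R \<longrightarrow> key x \<le> key z)"
      using ex_has_least_nat[of "\<lambda>x. x \<in> R" _ key] by blast
    then have "A \<noteq> {}" by (auto simp: A_def)
    then have "\<exists>x. x \<in> A \<and> (\<forall>z. z \<in> A \<longrightarrow> card {y \<in> L. lt x y} \<le> card {y \<in> L. lt z y})"
      using ex_has_least_nat[of "\<lambda>x. x \<in> A" _ "\<lambda>x. card {y \<in> L. lt x y}"] by blast
    then obtain x where x: "x \<in> A" and top: "\<And>z. z \<in> A \<Longrightarrow>
      card {y \<in> L. lt x y} \<le> card {y \<in> L. lt z y}"
      by blast
    have xR: "x \<in> R" "x \<in> L" and least: "\<And>z. z \<in> R \<Longrightarrow> key x \<le> key z" using x
      by (auto simp: A_def R_def)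
    have "y \<in> set ds" if y: "y \<in> L" "lt x y" for y
    proof (rule ccontr)
      assume "y \<notin> set ds"
      then have "y \<in> R" using y by (simp add: R_def)
      have "incl (map (lt y) ds) (map (lt x) ds)"
        unfolding incl_map using lt_trans y xR listing_subset[OF ds(1)] by blast
      then have "key y \<le> key x" unfolding key_def by (intro incl_rank) auto
      then have "y \<in> A" using \<open>y \<in> R\<close> least unfolding A_def by force
      have "{z \<in> L. lt y z} \<subseteq> {z \<in> L. lt x z}" "y \<in> {z \<in> L. lt x z}" "y \<notin> {z \<in> L. lt y z}"
        using lt_trans[OF xR(2) y(1)] y by auto
      then have "{z \<in> L. lt y z} \<subset> {z \<in> L. lt x z}" by blast
      then have "card {z \<in> L. lt y z} < card {z \<in> L. lt x z}"
        using fin by (intro psubset_card_mono) auto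
      then show False using top[OF \<open>y \<in> A\<close>] by simp
    qed
    then have "listing (x # ds)" using ds xR next_ok by (auto simp: R_def)
    moreover have "after (map (lt z) (x # ds)) (up_rows lt (x # ds))" if "z \<in> L - set (x # ds)"
      for z
      using least[of z] that lexle_iff_rank[of "map (lt x) ds" "map (lt z) ds"]
        by (simp add: R_def key_def)
    ultimately show ?case using ds by (intro exI[of _ "x # ds"]) simp
  qed
  then obtain ds where ds: "listing ds" "length ds = card L" by blast
  have "set ds = L"
    using ds listing_distinct listing_subset fin by (metis card_subset_eq distinct_card)
  with ds show ?thesis by blast
qed

lemma principal_iff:
  assumes "listing ds"
  shows "principal (map P ds) (up_rows lt ds) \<longleftrightarrow> (\<exists>y\<in>set ds. \<forall>z\<in>set ds. P z \<longleftrightarrow> z = y \<or> lt y z)"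
  using assms
proof (induction ds)
  case (Cons y ds)
  then have y: "y \<in> L" "y \<notin> set ds" and ds: "listing ds" by auto
  have no: "\<not> lt y' y" if "y' \<in> set ds" for y'
    using listing_up[OF ds that y(1)] y(2) by blast
  define Q where "Q ds y' \<longleftrightarrow> (\<forall>z\<in>set ds. P z \<longleftrightarrow> z = y' \<or> lt y' z)" for ds y'
  have head: "Q (y # ds) y' \<longleftrightarrow> \<not> P y \<and> Q ds y'" if "y' \<in> set ds" for y'
    unfolding Q_def using no[OF that] y(2) that by auto
  have "Q (y # ds) y \<longleftrightarrow> P y \<and> (\<forall>z\<in>set ds. P z \<longleftrightarrow> lt y z)"
    unfolding Q_def using y(2) by auto
  then have "Q (y # ds) y \<longleftrightarrow> P y \<and> same (map P ds) (map (lt y) ds)"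
    by (simp add: same_iff)
  moreover have "(\<exists>y'\<in>set (y # ds). Q (y # ds) y') \<longleftrightarrow> Q (y # ds) y \<or> (\<exists>y'\<in>set ds. \<not> P y \<and> Q ds y')"
    using head by simp
  moreover have "principal (map P ds) (up_rows lt ds) \<longleftrightarrow> (\<exists>y'\<in>set ds. Q ds y')"
    using Cons.IH[OF ds] unfolding Q_def .
  ultimately show ?case unfolding Q_def[symmetric] by auto
qed simp

lemma full_rows_up_rows:
  "listing ds \<Longrightarrow> full_rows (up_rows lt ds) = map (\<lambda>x. map (le x) ds) ds"
proof (induction ds)
  case (Cons x ds)
  have sub: "set ds \<subseteq> L" "x \<in> L" "x \<notin> set ds" "listing ds" using Cons.prems listing_subset by auto
  have "map (lt x) ds = map (le x) ds" using sub by (auto simp: lt_def)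
  moreover have "\<not> le z x" if "z \<in> set ds" for z
    using listing_up[OF sub(4) that sub(2)] sub(3) that by (auto simp: lt_def)
  ultimately show ?case using Cons sub by (auto simp: le_refl)
qed simp

text \<open>This makes the enumeration complete: the suffixes of a listing being up-closed, the join
  of \<open>x\<close> and an element \<open>e\<close> not above it is found among the elements listed before \<open>e\<close>.\<close>

lemma row_in_new_rows:
  assumes "listing ds" "x \<in> L" "\<forall>e\<in>set ds. \<not> le e x"
  shows "map (lt x) ds \<in> set (new_rows (up_rows lt ds))"
  using assms
proof (induction ds)
  case (Cons e ds)
  then have e: "e \<in> L" "e \<notin> set ds" "\<not> le e x" and ds: "listing ds"
    and up: "\<And>y. y \<in> L \<Longrightarrow> lt e y \<Longrightarrow> y \<in> set ds" by auto
  have sub: "z \<in> L" if "z \<in> set ds" for z using that listing_subset[OF ds] by auto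
  have IH: "map (lt x) ds \<in> set (new_rows (up_rows lt ds))" using Cons by auto
  have xe: "x \<noteq> e" using e le_refl by auto
  show ?case
  proof (cases "lt x e")
    case True
    then have "incl (map (lt e) ds) (map (lt x) ds)"
      unfolding incl_map using lt_trans Cons.prems(2) e(1) sub by blast
    then show ?thesis using True IH by (simp add: set_extend_rows)
  next
    case False
    define j where "j = join x e"
    have j: "j \<in> L" "le x j" "le e j" unfolding j_def using Cons.prems(2) e(1) closed le_join
      by auto
    have "j \<noteq> e" using False xe j by (auto simp: lt_def)
    then have "j \<in> set ds" using up j by (auto simp: lt_def)
    moreover have "lt x z \<and> lt e z \<longleftrightarrow> z = j \<or> lt j z" if "z \<in> set ds" for z
    proof -
      have "z \<noteq> x" "z \<noteq> e" using Cons.prems(3) e that le_refl sub by auto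
      moreover have "le j z \<longleftrightarrow> le x z \<and> le e z"
        unfolding j_def using join_le_iff Cons.prems(2) e(1) sub[OF that] by blast
      ultimately show ?thesis using j le_refl by (auto simp: lt_def)
    qed
    ultimately have "principal (mask_inter (map (lt x) ds) (map (lt e) ds)) (up_rows lt ds)"
      unfolding mask_inter_map principal_iff[OF ds] by blast
    then show ?thesis using False IH by (simp add: set_extend_rows)
  qed
qed simp

lemma pendant_if_not_pendant_free:
  assumes "listing ds" "\<not> pendant_free (map P ds) (up_rows lt ds)"
  shows "\<exists>bs x cs. ds = bs @ x # cs \<and> \<not> P x \<and> (\<forall>b\<in>set bs. \<not> lt b x) \<and>
    principal (map (lt x) cs) (up_rows lt cs)"
  using assms
proof (induction ds arbitrary: P)
  case (Cons d ds)
  show ?case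
  proof (cases "\<not> P d \<and> principal (map (lt d) ds) (up_rows lt ds)")
    case True
    then show ?thesis by (intro exI[of _ "[]"]) auto
  next
    case False
    then have "\<not> pendant_free (map (\<lambda>z. P z \<or> lt d z) ds) (up_rows lt ds)"
      using Cons.prems by (auto simp: mask_union_map split: if_splits)
    then obtain bs x cs where *: "ds = bs @ x # cs" "\<not> (P x \<or> lt d x)" "\<forall>b\<in>set bs. \<not> lt b x"
      "principal (map (lt x) cs) (up_rows lt cs)"
      using Cons.IH[of "\<lambda>z. P z \<or> lt d z"] Cons.prems by auto
    then show ?thesis by (intro exI[of _ "d # bs"]) auto
  qed
qed simp

text \<open>The element \<open>y\<close> is the single upper cover of the minimal element \<open>x\<close>, expressed in the
  form needed to attach \<open>x\<close> to a drawing.\<close>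

lemma ex_pendant:
  assumes ds: "listing ds" "set ds = L" and "\<not> pendant_free (zeros (up_rows lt ds)) (up_rows lt ds)"
  shows "\<exists>x\<in>L. \<exists>y\<in>L. x \<noteq> y \<and> (\<forall>z\<in>L. le z x \<longrightarrow> z = x) \<and> (\<forall>z\<in>L. z \<noteq> x \<longrightarrow> (le x z \<longleftrightarrow> le y z))"
proof -
  obtain bs x cs where dsx: "ds = bs @ x # cs" and below: "\<And>b. b \<in> set bs \<Longrightarrow> \<not> lt b x"
    and pr: "principal (map (lt x) cs) (up_rows lt cs)"
    using pendant_if_not_pendant_free[OF ds(1) assms(3)[unfolded zeros_up_rows]] by blast
  have cs: "listing (x # cs)" using ds(1) unfolding dsx by (rule listing_append)
  then have cs': "listing cs" by simp
  obtain y where y: "y \<in> set cs" and "\<forall>z\<in>set cs. lt x z \<longleftrightarrow> z = y \<or> lt y z"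
    using iffD1[OF principal_iff[OF cs'] pr] by (rule bexE)
  note above = bspec[OF this(2)]
  have inL: "x \<in> L" "y \<in> L" unfolding ds(2)[symmetric] dsx using y by simp_all
  have xy: "lt x y" using above[OF y] by simp
  have min: "z = x" if z: "z \<in> L" "le z x" for z
  proof (rule ccontr)
    assume "z \<noteq> x"
    then have "lt z x" using z by (simp add: lt_def)
    moreover have "z \<in> set bs \<or> z = x \<or> z \<in> set cs" using z(1) unfolding ds(2)[symmetric] dsx
      by auto
    ultimately have "z \<in> set cs" using below \<open>z \<noteq> x\<close> by blast
    then have "x \<in> set cs" using listing_up[OF cs'] inL \<open>lt z x\<close> by blast
    then show False using cs by auto
  qed
  have "\<forall>z\<in>L. z \<noteq> x \<longrightarrow> (le x z \<longleftrightarrow> le y z)"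
  proof (intro ballI impI)
    fix z assume z: "z \<in> L" "z \<noteq> x"
    show "le x z \<longleftrightarrow> le y z"
    proof
      assume "le x z"
      then have "lt x z" using z by (auto simp: lt_def)
      then have "z \<in> set cs" using cs z by auto
      then show "le y z" using above[of z] \<open>lt x z\<close> le_refl[OF z(1)] by (auto simp: lt_def)
    next
      assume "le y z"
      then show "le x z" using le_trans[of x y z] xy inL z by (auto simp: lt_def)
    qed
  qed
  moreover have "x \<noteq> y" using xy by (simp add: lt_def)
  ultimately show ?thesis using min inL by blast
qed

end

context join_semilattice_on begin

definition full_row :: "'a list \<Rightarrow> 'a \<Rightarrow> mask" where
  "full_row ds x = map (le x) ds"

lemma full_rows_eq: "listing ds \<Longrightarrow> full_rows (up_rows lt ds) = map (full_row ds) ds"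
  by (simp add: full_rows_up_rows full_row_def)

lemma incl_full_row:
  assumes "set ds = L" "x \<in> L" "y \<in> L"
  shows "incl (full_row ds y) (full_row ds x) \<longleftrightarrow> le x y"
proof -
  have "(\<forall>z\<in>L. le y z \<longrightarrow> le x z) \<longleftrightarrow> le x y"
    using le_trans[OF assms(2,3)] le_refl[OF assms(3)] assms(3) by blast
  then show ?thesis using assms(1) by (simp add: full_row_def incl_map)
qed

lemma inj_full_row:
  assumes "set ds = L"
  shows "inj_on (full_row ds) L"
proof (rule inj_onI)
  fix x y assume xy: "x \<in> L" "y \<in> L" "full_row ds x = full_row ds y"
  have "le x y" "le y x"
    using incl_full_row[OF assms xy(1,2)] incl_full_row[OF assms xy(2,1)] xy(3) by simp_all
  then show "x = y" using le_antisym xy(1,2) by blast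
qed

lemma full_row_join:
  assumes "set ds = L" "x \<in> L" "y \<in> L"
  shows "full_row ds (join x y) = mask_inter (full_row ds x) (full_row ds y)"
  using join_le_iff[OF assms(2,3)] assms(1) by (simp add: full_row_def mask_inter_map)

end

section \<open>Searching for a realizer\<close>

text \<open>A linear extension is kept as a list, lowest element first, of full rows. Placing \<open>c\<close>
  below the list \<open>ws\<close> is permitted if no \<open>b\<close> between \<open>c\<close> and some \<open>w \<ge> c\<close> is incomparable to
  both. Traversing \<open>ws\<close>, the argument \<open>A\<close> collects the intersection of the elements \<open>b\<close> met so
  far that are not above \<open>c\<close>; they are all below \<open>w\<close> exactly if \<open>w\<close> is included in \<open>A\<close>.\<close>

fun okay :: "mask \<Rightarrow> mask list \<Rightarrow> mask \<Rightarrow> bool" where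
  "okay c [] A = True"
| "okay c (w # ws) A =
    (if incl w c then (if incl w A then okay c ws A else False) else okay c ws (mask_inter A w))"

fun maximal_in :: "mask \<Rightarrow> mask list \<Rightarrow> bool" where
  "maximal_in c [] = True"
| "maximal_in c (d # ds) = (if incl d c then False else maximal_in c ds)"

fun ones :: "mask \<Rightarrow> mask" where
  "ones [] = []"
| "ones (b # r) = True # ones r"

text \<open>Backtracking over all nonseparating linear extensions, built from the top. The candidates
  in \<open>skipped\<close> have been tried at the current position. Nested conditionals, here and elsewhere,
  keep the simplifier from evaluating branches that are not reached.\<close>

function search :: "mask list \<Rightarrow> mask list \<Rightarrow> mask list \<Rightarrow> bool" where
  "search ws skipped [] = (case skipped of [] \<Rightarrow> True | _ \<Rightarrow> False)"
| "search ws skipped (c # rem) =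
    (if (if maximal_in c skipped
         then (if maximal_in c rem
               then (if okay c ws (ones c) then search (c # ws) [] (skipped @ rem) else False)
               else False)
         else False)
     then True else search ws (skipped @ [c]) rem)"
  by pat_completeness auto
termination by (relation "measures [\<lambda>(ws, s, r). length s + length r, \<lambda>(ws, s, r). length r]") auto

primrec nonseparating :: "mask list \<Rightarrow> bool" where
  "nonseparating [] \<longleftrightarrow> True"
| "nonseparating (c # ws) \<longleftrightarrow> nonseparating ws \<and> okay c ws (ones c) \<and> (\<forall>w\<in>set ws. \<not> incl c w)"

lemma maximal_in_iff: "maximal_in c ds \<longleftrightarrow> (\<forall>d\<in>set ds. \<not> incl d c)"
  by (induction ds) auto

lemma search_nonseparating:
  assumes "search ws skipped rem" "nonseparating ws"
    and "\<forall>x\<in>set skipped \<union> set rem. \<forall>w\<in>set ws. \<not> incl x w"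
  shows "\<exists>zs. set zs = set ws \<union> set skipped \<union> set rem \<and> nonseparating zs"
  using assms
proof (induction ws skipped rem rule: search.induct)
  case (1 ws skipped)
  then show ?case by (intro exI[of _ ws]) (auto split: list.splits)
next
  case (2 ws skipped c rem)
  show ?case
  proof (cases "maximal_in c skipped \<and> maximal_in c rem \<and> okay c ws (ones c) \<and>
    search (c # ws) [] (skipped @ rem)")
    case True
    have "\<exists>zs. set zs = set (c # ws) \<union> set [] \<union> set (skipped @ rem) \<and> nonseparating zs"
    proof (rule "2.IH"(1))
      show "nonseparating (c # ws)" using True 2 by simp
      show "\<forall>x\<in>set [] \<union> set (skipped @ rem). \<forall>w\<in>set (c # ws). \<not> incl x w"
        using True 2 by (auto simp: maximal_in_iff)
    qed (use True in auto)
    then show ?thesis by auto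
  next
    case False
    then have "search ws (skipped @ [c]) rem" using "2.prems"(1) by (auto split: if_splits)
    then have "\<exists>zs. set zs = set ws \<union> set (skipped @ [c]) \<union> set rem \<and> nonseparating zs"
      using False "2.prems" by (intro "2.IH"(2)) auto
    then show ?thesis by auto
  qed
qed

lemma okay_nonseparating:
  fixes f :: "mask \<Rightarrow> real"
  assumes "okay c ws A" "sorted_wrt (\<lambda>a b. f a < f b) ws" "length A = n" "\<forall>w\<in>set ws. length w = n"
    and "w \<in> set ws" "incl w c"
  shows "incl w A \<and> (\<forall>b\<in>set ws. f b < f w \<longrightarrow> \<not> incl b c \<longrightarrow> incl w b)"
  using assms
proof (induction ws arbitrary: A)
  case (Cons v ws)
  show ?case
  proof (cases "w = v")
    case True
    have "\<not> f b < f v" if "b \<in> set (v # ws)" for b using that Cons.prems(2) by auto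
    moreover have "incl v A" using Cons.prems(1,6) True by (simp split: if_splits)
    ultimately show ?thesis using True by blast
  next
    case False
    then have w: "w \<in> set ws" using Cons.prems by simp
    show ?thesis
    proof (cases "incl v c")
      case True
      then have "okay c ws A" using Cons.prems by (simp split: if_splits)
      then show ?thesis using Cons.IH[of A] Cons.prems w True by simp
    next
      case False
      then have "okay c ws (mask_inter A v)" using Cons.prems by simp
      moreover have "length (mask_inter A v) = n" using Cons.prems by simp
      ultimately have "incl w (mask_inter A v)" "\<forall>b\<in>set ws. f b < f w \<longrightarrow> \<not> incl b c \<longrightarrow> incl w b"
        using Cons.IH[of "mask_inter A v"] Cons.prems w by simp_all
      then show ?thesis using Cons.prems w by (simp add: incl_mask_inter)
    qed
  qed
qed simp

lemma real_between:
  fixes A B :: "real set"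
  assumes "finite A" "finite B" "\<And>a b. a \<in> A \<Longrightarrow> b \<in> B \<Longrightarrow> a < b"
  shows "\<exists>v. (\<forall>a\<in>A. a < v) \<and> (\<forall>b\<in>B. v < b)"
proof (cases "A = {} \<or> B = {}")
  case True
  then show ?thesis
  proof
    assume A: "A = {}"
    show ?thesis
    proof (cases "B = {}")
      case False
      have "\<forall>b\<in>B. Min B - 1 < b"
      proof
        fix b assume "b \<in> B"
        then show "Min B - 1 < b" using Min_le[OF assms(2)] by fastforce
      qed
      then show ?thesis using A by blast
    qed (simp add: A)
  next
    assume B: "B = {}"
    have "\<forall>a\<in>A. a < Max A + 1"
    proof
      fix a assume "a \<in> A"
      then show "a < Max A + 1" using Max_ge[OF assms(1)] by fastforce
    qed
    then show ?thesis using B by blast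
  qed
next
  case False
  then have "Max A < Min B" using assms by simp
  then obtain v where "Max A < v" "v < Min B" using dense by blast
  then show ?thesis using assms False by (intro exI[of _ v]) auto
qed

text \<open>An order has dimension at most two if and only if it has a linear extension without
  separation. Here \<open>f\<close> is the position in that extension, and \<open>g\<close> is built along the list: the
  new lowest element \<open>c\<close> must be put to the left of its upper bounds and to the right of all
  elements incomparable to it, and the absence of separation says that the latter are to the left
  of the former.\<close>

lemma realizer_if_nonseparating:
  assumes "nonseparating zs" "\<forall>z\<in>set zs. length z = n"
  shows "\<exists>(f :: mask \<Rightarrow> real) (g :: mask \<Rightarrow> real). sorted_wrt (\<lambda>a b. f a < f b) zs \<and>
    inj_on g (set zs) \<and>
    (\<forall>a\<in>set zs. \<forall>b\<in>set zs. incl b a \<longleftrightarrow> f a \<le> f b \<and> g a \<le> g b)"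
  using assms
proof (induction zs)
  case (Cons c ws)
  have "\<exists>(f :: mask \<Rightarrow> real) (g :: mask \<Rightarrow> real). sorted_wrt (\<lambda>a b. f a < f b) ws \<and>
    inj_on g (set ws) \<and>
    (\<forall>a\<in>set ws. \<forall>b\<in>set ws. incl b a \<longleftrightarrow> f a \<le> f b \<and> g a \<le> g b)"
    by (rule Cons.IH) (use Cons.prems in auto)
  then obtain f g :: "mask \<Rightarrow> real" where f: "sorted_wrt (\<lambda>a b. f a < f b) ws"
    and g: "inj_on g (set ws)"
    and "\<forall>a\<in>set ws. \<forall>b\<in>set ws. incl b a \<longleftrightarrow> f a \<le> f b \<and> g a \<le> g b"
    by (elim exE conjE)
  note fg = bspec[OF bspec[OF this(3)]]
  have ok: "okay c ws (ones c)" and new: "\<And>w. w \<in> set ws \<Longrightarrow> \<not> incl c w" using Cons.prems by auto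
  have len: "length (ones c) = n" "\<And>w. w \<in> set ws \<Longrightarrow> length w = n" "length c = n"
  proof -
    have "length (ones c) = length c" by (induction c) auto
    then show "length (ones c) = n" using Cons.prems by simp
  qed (use Cons.prems in auto)
  have notin: "c \<notin> set ws" using new[of c] by auto
  have gap: "g b < g w" if b: "b \<in> set ws" "\<not> incl b c" and w: "w \<in> set ws" "incl w c" for b w
  proof -
    have "b \<noteq> w" using b w by auto
    then have "g b \<noteq> g w" using g b w by (auto dest: inj_onD)
    moreover have "g b \<le> g w"
    proof (cases "f b < f w")
      case True
      have "\<forall>w\<in>set ws. length w = n" using len by blast
      then have "incl w b"
        using okay_nonseparating[OF ok f len(1) _ w] b True by blast
      then show ?thesis using fg[OF b(1) w(1)] by simp
    next
      case False
      show ?thesis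
      proof (rule ccontr)
        assume "\<not> g b \<le> g w"
        then have "incl b w" using fg[OF w(1) b(1)] False by simp
        then have "incl b c" using incl_trans[of b w c] w b len by simp
        then show False using b by simp
      qed
    qed
    ultimately show ?thesis by simp
  qed
  have "\<exists>v. (\<forall>a\<in>g ` {b \<in> set ws. \<not> incl b c}. a < v) \<and> (\<forall>a\<in>g ` {w \<in> set ws. incl w c}. v < a)"
    using gap by (intro real_between) auto
  then obtain v where v: "\<And>b. b \<in> set ws \<Longrightarrow> \<not> incl b c \<Longrightarrow> g b < v"
    "\<And>w. w \<in> set ws \<Longrightarrow> incl w c \<Longrightarrow> v < g w"
    by auto
  have "\<exists>u. (\<forall>a\<in>{}. a < u) \<and> (\<forall>a\<in>f ` set ws. u < a)"
    by (rule real_between) auto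
  then obtain u where u: "\<And>w. w \<in> set ws \<Longrightarrow> u < f w" by auto
  have vg: "v \<noteq> g w" if "w \<in> set ws" for w using v that by (cases "incl w c") force+
  let ?f = "f(c := u)" and ?g = "g(c := v)"
  have "sorted_wrt (\<lambda>a b. ?f a < ?f b) ws"
    using f by (rule sorted_wrt_mono_rel[rotated]) (use notin in auto)
  then have "sorted_wrt (\<lambda>a b. ?f a < ?f b) (c # ws)" using u notin by auto
  moreover have "inj_on ?g (set (c # ws))"
    using g vg notin by (auto simp: inj_on_def)
  moreover have "incl b a \<longleftrightarrow> ?f a \<le> ?f b \<and> ?g a \<le> ?g b" if a: "a \<in> set (c # ws)"
    and b: "b \<in> set (c # ws)" for a b
  proof -
    consider "a = c" "b = c" | "a = c" "b \<in> set ws" | "a \<in> set ws" "b = c" | "a \<in> set ws"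
      "b \<in> set ws"
      using a b by auto
    then show ?thesis
    proof cases
      case 1 then show ?thesis by simp
    next
      case 2
      then have "b \<noteq> c" using notin by auto
      then show ?thesis using 2 u[of b] v[of b] by (cases "incl b c") auto
    next
      case 3
      then have "a \<noteq> c" using notin by auto
      then show ?thesis using 3 u[of a] new[of a] by auto
    next
      case 4
      then have "a \<noteq> c" "b \<noteq> c" using notin by auto
      then show ?thesis using fg[OF 4] by simp
    qed
  qed
  ultimately show ?case by blast
qed simp

context join_semilattice_on begin

lemma planar_if_search:
  assumes ds: "listing ds" "set ds = L" and s: "search [] [] (full_rows (up_rows lt ds))"
  shows "planar_semilattice L join"
proof -
  obtain zs where zs: "set zs = full_row ds ` L" "nonseparating zs"
    using search_nonseparating[OF s] ds by (auto simp: full_rows_eq)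
  have "\<forall>z\<in>set zs. length z = length ds" unfolding zs by (auto simp: full_row_def)
  then obtain f g :: "mask \<Rightarrow> real" where
    fg: "\<forall>a\<in>set zs. \<forall>b\<in>set zs. incl b a \<longleftrightarrow> f a \<le> f b \<and> g a \<le> g b"
    using realizer_if_nonseparating[OF zs(2)] by blast
  show ?thesis
  proof (rule planar_if_two_dimensional)
    fix x y assume xy: "x \<in> L" "y \<in> L"
    show "le x y \<longleftrightarrow> f (full_row ds x) \<le> f (full_row ds y) \<and> g (full_row ds x) \<le> g (full_row ds y)"
      using fg xy unfolding zs incl_full_row[OF ds(2) xy, symmetric] by simp
  qed
qed

end

section \<open>Exceptional drawings\<close>

text \<open>An element of a drawing is a full row together with its point.\<close>

definition covers :: "(mask \<times> int \<times> int) list \<Rightarrow> mask \<times> int \<times> int \<Rightarrow> mask \<times> int \<times> int \<Rightarrow> bool" where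
  "covers Z a b \<longleftrightarrow> a \<noteq> b \<and> incl (fst b) (fst a) \<and>
    (\<forall>z\<in>set Z. z = a \<or> z = b \<or> \<not> (incl (fst z) (fst a) \<and> incl (fst b) (fst z)))"

definition cover_pairs where
  "cover_pairs Z = filter (\<lambda>e. covers Z (fst e) (snd e)) (List.product Z Z)"

definition plane_drawing where
  "plane_drawing Z E \<longleftrightarrow> distinct (map snd Z) \<and>
    (\<forall>e\<in>set E. snd (snd (fst e)) < snd (snd (snd e)) \<and>
      (\<forall>z\<in>set Z. z = fst e \<or> z = snd e \<or> orient (snd (fst e)) (snd (snd e)) (snd z) \<noteq> 0)) \<and>
    (\<forall>e\<in>set E. \<forall>e'\<in>set E. e = e' \<or>
      noncrossing (snd (fst e)) (snd (snd e)) (snd (fst e')) (snd (snd e')))"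

lemma planar_if_plane_drawing:
  assumes "plane_drawing Z (cover_pairs Z)"
  shows "planar_poset (set Z) (\<lambda>a b. incl (fst b) (fst a))"
proof (rule planar_poset_by_drawing)
  have mem: "(a, b) \<in> set (cover_pairs Z)"
    if "(a, b) \<in> coverings (set Z) (\<lambda>a b. incl (fst b) (fst a))" for a b
    using that unfolding cover_pairs_def covers_def coverings_def by auto
  note d = assms[unfolded plane_drawing_def]
  show "inj_on snd (set Z)" using d by (auto simp: distinct_map)
  show "snd (snd x) < snd (snd y) \<and> (z = x \<or> z = y \<or> orient (snd x) (snd y) (snd z) \<noteq> 0)"
    if "(x, y) \<in> coverings (set Z) (\<lambda>a b. incl (fst b) (fst a))" "z \<in> set Z" for x y z
    using d[THEN conjunct2, THEN conjunct1, THEN bspec, OF mem[OF that(1)]] that(2) by simp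
  show "x = u \<and> y = v \<or> noncrossing (snd x) (snd y) (snd u) (snd v)"
    if "(x, y) \<in> coverings (set Z) (\<lambda>a b. incl (fst b) (fst a))"
      "(u, v) \<in> coverings (set Z) (\<lambda>a b. incl (fst b) (fst a))" for x y u v
    using d[THEN conjunct2, THEN conjunct2, THEN bspec, OF mem[OF that(1)], THEN bspec,
      OF mem[OF that(2)]] by simp
qed

abbreviation (input) I where "I \<equiv> True"
abbreviation (input) N where "N \<equiv> False"

text \<open>The semilattices without pendant elements that are planar but of dimension three, as far
  as they matter: the non-zero elements of the Boolean lattice with three atoms, and an
  eight-element semilattice under both of its sorted listings. A point is given for each row,
  lowest element first.\<close>

definition atlas :: "(mask list \<times> (int \<times> int) list) list" where
  "atlas =
    [([[N,N,I,I,N,I], [N,I,N,I,I], [N,I,I,I], [N,N,I], [N,I], [I], []],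
      [(2, 2), (3, 1), (4, 0), (2, 3), (0, 3), (3, 3), (0, 4)]),
     ([[N,I,I,N,I,I,I], [I,N,I,I,I,I], [N,N,I,I,I], [N,N,I,I], [N,I,I], [N,I], [I], []],
      [(1, 0), (1, 1), (0, 2), (4, 2), (3, 2), (0, 3), (1, 3), (4, 4)]),
     ([[N,I,I,N,I,I,I], [I,N,I,I,I,I], [N,N,I,I,I], [N,I,N,I], [I,N,I], [N,I], [I], []],
      [(2, 0), (2, 1), (4, 2), (0, 2), (1, 2), (1, 3), (3, 3), (3, 4)])]"

lemma atlas_drawings:
  "list_all (\<lambda>(t, ps). length ps = length t \<and>
    plane_drawing (zip (full_rows t) ps) (cover_pairs (zip (full_rows t) ps))) atlas"
  by code_simp

definition settled :: "mask list \<Rightarrow> bool" where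
  "settled t = (if search [] [] (full_rows t) then True else list_ex (\<lambda>e. fst e = t) atlas)"

context join_semilattice_on begin

lemma planar_if_settled:
  assumes ds: "listing ds" "set ds = L" and settled: "settled (up_rows lt ds)"
  shows "planar_semilattice L join"
proof (cases "search [] [] (full_rows (up_rows lt ds))")
  case True
  then show ?thesis using planar_if_search ds by blast
next
  case False
  then obtain ps where "(up_rows lt ds, ps) \<in> set atlas"
    using settled by (auto simp: settled_def list_ex_iff split: if_splits)
  then have ps: "length ps = length ds"
    and drawing:
      "plane_drawing (zip (map (full_row ds) ds) ps) (cover_pairs (zip (map (full_row ds) ds) ps))"
    using atlas_drawings ds(1) by (auto simp: list_all_iff full_rows_eq)
  define point where "point x = the (map_of (zip ds ps) x)" for x
  have "map point ds = ps"
    using ps listing_distinct[OF ds(1)]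
    by (intro nth_equalityI) (simp_all add: point_def map_of_zip_nth)
  then have "zip (map (full_row ds) ds) ps = map (\<lambda>x. (full_row ds x, point x)) ds"
    by (auto simp: zip_map_map zip_same_conv_map)
  then have image: "set (zip (map (full_row ds) ds) ps) = (\<lambda>x. (full_row ds x, point x)) ` L"
    using ds(2) by simp
  show ?thesis
    unfolding planar_semilattice_def
  proof (rule planar_poset_transfer)
    show "inj_on (\<lambda>x. (full_row ds x, point x)) L"
      using inj_full_row[OF ds(2)] by (auto simp: inj_on_def)
    show "planar_poset ((\<lambda>x. (full_row ds x, point x)) ` L) (\<lambda>a b. incl (fst b) (fst a))"
      using planar_if_plane_drawing[OF drawing] unfolding image .
    show "le x y \<longleftrightarrow> incl (fst (full_row ds y, point y)) (fst (full_row ds x, point x))"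
      if "x \<in> L" "y \<in> L" for x y
      using incl_full_row[OF ds(2) that] by simp
  qed
qed

end

section \<open>Counting subsemilattices\<close>

fun occurs :: "mask \<Rightarrow> mask list \<Rightarrow> bool" where
  "occurs w [] = False"
| "occurs w (s # S) = (if same w s then True else occurs w S)"

fun compatible :: "mask \<Rightarrow> mask list \<Rightarrow> mask list \<Rightarrow> bool" where
  "compatible r T [] = True"
| "compatible r T (s # S) =
    (if incl s r then compatible r T S
     else if occurs (mask_inter r s) T then compatible r T S else False)"

text \<open>Here \<open>T\<close> holds the chosen and \<open>R\<close> the undecided elements, upper elements first. As the
  join of two elements is never below either of them, the decision on \<open>r\<close> has to be compatible
  only with the elements already chosen.\<close>

fun closed_count :: "mask list \<Rightarrow> mask list \<Rightarrow> int" where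
  "closed_count T [] = 1"
| "closed_count T (r # R) =
    (if compatible r T T then closed_count (r # T) R else 0) + closed_count T R"

lemma occurs_iff: "occurs w S \<longleftrightarrow> w \<in> set S"
  by (induction S) (auto simp: same_iff)

lemma mask_inter_commute: "mask_inter r v = mask_inter v r"
  by (induction r v rule: mask_inter.induct) auto

lemma mask_inter_self: "mask_inter r r = r"
  by (induction r) auto

lemma mask_inter_incl: "incl (mask_inter r v) r"
  by (induction r v rule: mask_inter.induct) auto

lemma mask_inter_absorb: "length r = length s \<Longrightarrow> incl s r \<Longrightarrow> mask_inter r s = s"
  by (induction r s rule: mask_inter.induct) (auto split: if_splits)

definition inter_closed :: "mask set \<Rightarrow> bool" where
  "inter_closed X \<longleftrightarrow> (\<forall>a\<in>X. \<forall>b\<in>X. mask_inter a b \<in> X)"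

lemma compatible_iff:
  "\<forall>s\<in>set S. length r = length s \<Longrightarrow> set S \<subseteq> set T \<Longrightarrow>
    compatible r T S \<longleftrightarrow> (\<forall>s\<in>set S. mask_inter r s \<in> set T)"
  by (induction S) (auto simp: occurs_iff mask_inter_absorb)

text \<open>Adding \<open>r\<close> to the chosen elements \<open>T\<close> excludes nothing but what \<open>compatible\<close> excludes,
  because the join of \<open>r\<close> with an element \<open>s\<close> chosen earlier is neither \<open>r\<close> nor decided later: it
  is above \<open>s\<close>, and elements above \<open>s\<close> come before \<open>s\<close>.\<close>

lemma closed_count:
  assumes "inter_closed (set T)" "sorted_wrt (\<lambda>s r. \<not> incl r s) R" "\<forall>s\<in>set T. \<forall>r\<in>set R. \<not> incl r s"
    and "\<forall>s\<in>set T \<union> set R. length s = n"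
  shows "closed_count T R = int (card {S. S \<subseteq> set R \<and> inter_closed (S \<union> set T)})"
  using assms
proof (induction R arbitrary: T)
  case Nil
  then have "S \<subseteq> set [] \<and> inter_closed (S \<union> set T) \<longleftrightarrow> S = {}" for S by auto
  then show ?case by simp
next
  case (Cons r R)
  let ?X = "\<lambda>T. {S. S \<subseteq> set R \<and> inter_closed (S \<union> set T)}"
  have rR: "r \<notin> set R" "r \<notin> set T"
    using Cons.prems(2,3) incl_refl[of r] unfolding sorted_wrt.simps by (blast, force)
  have comp: "compatible r T T \<longleftrightarrow> (\<forall>s\<in>set T. mask_inter r s \<in> set T)"
    by (rule compatible_iff) (use Cons.prems(4) in auto)
  have stay: "mask_inter r s \<in> set T" if S: "S \<subseteq> set R" "inter_closed (insert r S \<union> set T)"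
    and s: "s \<in> set T" for S s
  proof -
    have "mask_inter r s \<in> insert r S \<union> set T"
      using S(2)[unfolded inter_closed_def, THEN bspec, of r, THEN bspec, of s] s by simp
    moreover have "incl (mask_inter r s) s" by (subst mask_inter_commute) (rule mask_inter_incl)
    then have "mask_inter r s \<notin> set (r # R)" using Cons.prems(3) s by blast
    ultimately show ?thesis using S(1) by auto
  qed
  have split: "{S. S \<subseteq> set (r # R) \<and> inter_closed (S \<union> set T)} =
      ?X T \<union> insert r ` {S. S \<subseteq> set R \<and> inter_closed (insert r S \<union> set T)}"
    (is "?A = ?B \<union> insert r ` ?C")
  proof
    show "?A \<subseteq> ?B \<union> insert r ` ?C"
    proof
      fix S assume S: "S \<in> ?A"
      show "S \<in> ?B \<union> insert r ` ?C"
      proof (cases "r \<in> S")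
        case True
        then have S': "insert r (S - {r}) = S" by blast
        have "S - {r} \<subseteq> set R" "inter_closed (S \<union> set T)" using S by auto
        then have "S - {r} \<in> ?C" unfolding mem_Collect_eq S' by blast
        then show ?thesis using S' by blast
      next
        case False
        then show ?thesis using S by auto
      qed
    qed
    show "?B \<union> insert r ` ?C \<subseteq> ?A"
      unfolding image_subset_iff Un_subset_iff by (auto simp: subset_insertI2)
  qed
  have fin: "finite ?B" "finite ?C" by (rule finite_subset[of _ "Pow (set R)"]; auto)+
  have "card ?A = card ?B + card (insert r ` ?C)"
    unfolding split by (rule card_Un_disjoint) (use fin rR in auto)
  also have "card (insert r ` ?C) = card ?C"
    by (rule card_image) (use rR in \<open>auto simp: inj_on_def\<close>)
  finally have card: "card ?A = card ?B + card ?C" .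
  have B: "closed_count T R = int (card ?B)"
    using Cons.prems by (intro Cons.IH) auto
  show ?case
  proof (cases "compatible r T T")
    case True
    then have T: "mask_inter r s \<in> set T" if "s \<in> set T" for s using comp that by blast
    then have T': "mask_inter s r \<in> set T" if "s \<in> set T" for s using that
      by (subst mask_inter_commute)
    have "inter_closed (set (r # T))"
      using Cons.prems(1) T T' by (auto simp: inter_closed_def mask_inter_self)
    then have "closed_count (r # T) R = int (card (?X (r # T)))"
      using Cons.prems by (intro Cons.IH) auto
    moreover have "?X (r # T) = ?C" by simp
    ultimately show ?thesis using True B card by simp
  next
    case False
    then obtain s where "s \<in> set T" "mask_inter r s \<notin> set T" using comp by blast
    then have "?C = {}" using stay by blast
    then show ?thesis using False B card by simp
  qed
qed

lemma card_subsemilattices_image: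
  assumes inj: "inj_on \<phi> L" and hom: "\<And>x y. x \<in> L \<Longrightarrow> y \<in> L \<Longrightarrow> \<phi> (join x y) = join' (\<phi> x) (\<phi> y)"
    and closed: "\<And>x y. x \<in> L \<Longrightarrow> y \<in> L \<Longrightarrow> join x y \<in> L"
  shows "card (subsemilattices (\<phi> ` L) join') = card (subsemilattices L join)"
proof -
  have closed_image: "(\<forall>x\<in>\<phi> ` S. \<forall>y\<in>\<phi> ` S. join' x y \<in> \<phi> ` S) \<longleftrightarrow> (\<forall>x\<in>S. \<forall>y\<in>S. join x y \<in> S)"
    if S: "S \<subseteq> L" for S
  proof -
    have "join' (\<phi> x) (\<phi> y) \<in> \<phi> ` S \<longleftrightarrow> join x y \<in> S" if "x \<in> S" "y \<in> S" for x y
    proof -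
      have "x \<in> L" "y \<in> L" using that S by auto
      then show ?thesis using inj_on_image_mem_iff[OF inj closed S] by (simp add: hom[symmetric])
    qed
    then show ?thesis by simp
  qed
  have "subsemilattices (\<phi> ` L) join' = (\<lambda>S. \<phi> ` S) ` subsemilattices L join"
  proof
    show "subsemilattices (\<phi> ` L) join' \<subseteq> (\<lambda>S. \<phi> ` S) ` subsemilattices L join"
    proof
      fix T assume T: "T \<in> subsemilattices (\<phi> ` L) join'"
      then have "T \<subseteq> \<phi> ` L" by (simp add: subsemilattices_def)
      then obtain S where S: "S \<subseteq> L" "T = \<phi> ` S" unfolding subset_image_iff by blast
      then have "S \<in> subsemilattices L join" using T closed_image[OF S(1)]
        by (simp add: subsemilattices_def)
      then show "T \<in> (\<lambda>S. \<phi> ` S) ` subsemilattices L join" using S by blast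
    qed
    show "(\<lambda>S. \<phi> ` S) ` subsemilattices L join \<subseteq> subsemilattices (\<phi> ` L) join'"
    proof (rule image_subsetI)
      fix S assume "S \<in> subsemilattices L join"
      then have "S \<noteq> {}" "S \<subseteq> L" "\<forall>x\<in>S. \<forall>y\<in>S. join x y \<in> S" by (simp_all add: subsemilattices_def)
      then show "\<phi> ` S \<in> subsemilattices (\<phi> ` L) join'"
        using closed_image[of S] by (simp add: subsemilattices_def image_mono)
    qed
  qed
  moreover have "inj_on (\<lambda>S. \<phi> ` S) (subsemilattices L join)"
    by (rule inj_on_subset[OF inj_on_image_Pow[OF inj]]) (auto simp: subsemilattices_def)
  ultimately show ?thesis by (simp add: card_image)
qed

lemma card_subsemilattices_masks:
  assumes "sorted_wrt (\<lambda>s r. \<not> incl r s) zs" "\<forall>z\<in>set zs. length z = n"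
  shows "int (card (subsemilattices (set zs) mask_inter)) + 1 = closed_count [] zs"
proof -
  have "{S. S \<subseteq> set zs \<and> inter_closed (S \<union> set [])} =
    insert {} (subsemilattices (set zs) mask_inter)"
    unfolding subsemilattices_def inter_closed_def by auto
  moreover have "{} \<notin> subsemilattices (set zs) mask_inter" by (simp add: subsemilattices_def)
  moreover have "finite (subsemilattices (set zs) mask_inter)"
    by (rule finite_subset[of _ "Pow (set zs)"]) (auto simp: subsemilattices_def)
  moreover have "closed_count [] zs = int (card {S. S \<subseteq> set zs \<and> inter_closed (S \<union> set [])})"
    by (rule closed_count[where n = n]) (use assms in \<open>auto simp: inter_closed_def\<close>)
  ultimately show ?thesis by simp
qed

lemma (in join_semilattice_on) card_subsemilattices_listing:
  assumes ds: "listing ds" "set ds = L"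
  shows "int (card (subsemilattices L join)) + 1 =
    closed_count [] (rev (full_rows (up_rows lt ds)))"
proof -
  have "sorted_wrt (\<lambda>x y. \<not> le y x) ds"
    using ds(1)
  proof (induction ds)
    case (Cons x ds)
    then have "x \<in> L" "x \<notin> set ds" "listing ds" by auto
    then have "\<not> le y x" if "y \<in> set ds" for y using listing_up[of ds y x] that
      by (auto simp: lt_def)
    then show ?case using Cons by simp
  qed simp
  then have "sorted_wrt (\<lambda>x y. \<not> incl (full_row ds x) (full_row ds y)) ds"
    by (rule sorted_wrt_mono_rel[rotated]) (use incl_full_row ds in blast)
  then have sorted: "sorted_wrt (\<lambda>s r. \<not> incl r s) (rev (full_rows (up_rows lt ds)))"
    unfolding full_rows_eq[OF ds(1)] by (simp add: sorted_wrt_rev sorted_wrt_map)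
  have "card (subsemilattices (full_row ds ` L) mask_inter) = card (subsemilattices L join)"
    using inj_full_row[OF ds(2)] full_row_join[OF ds(2)] closed by (rule card_subsemilattices_image)
  moreover have
    "int (card (subsemilattices (set (rev (full_rows (up_rows lt ds)))) mask_inter)) + 1 =
      closed_count [] (rev (full_rows (up_rows lt ds)))"
    by (rule card_subsemilattices_masks[OF sorted, of "length ds"])
      (auto simp: full_rows_eq[OF ds(1)] full_row_def)
  moreover have "set (rev (full_rows (up_rows lt ds))) = full_row ds ` L"
    using ds by (simp add: full_rows_eq)
  ultimately show ?thesis by simp
qed

text \<open>Complementation turns the union into an intersection of masks.\<close>

definition A0_row :: "nat set \<Rightarrow> mask" where
  "A0_row S = map (\<lambda>i. i \<notin> S) [0, 1, 2]"

definition A0_rows :: "mask list" where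
  "A0_rows = [[N,N,N], [N,N,I], [N,I,N], [N,I,I], [I,N,N], [I,N,I], [I,I,N], [I,I,I]]"

lemma card_subsemilattices_A0: "card (subsemilattices A0 (\<union>)) = 121"
proof -
  have "inj_on A0_row A0"
  proof (rule inj_onI)
    fix S T assume "S \<in> A0" "T \<in> A0" "A0_row S = A0_row T"
    then show "S = T" by (fastforce simp: A0_row_def A0_def)
  qed
  then have "card (subsemilattices (A0_row ` A0) mask_inter) = card (subsemilattices A0 (\<union>))"
    by (rule card_subsemilattices_image) (auto simp: A0_row_def A0_def)
  moreover have "A0_row ` A0 = set A0_rows"
    by (simp add: A0_def A0_rows_def A0_row_def Pow_insert image_Un image_image insert_commute
      Un_commute)
  moreover have "int (card (subsemilattices (set A0_rows) mask_inter)) + 1 =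
    closed_count [] A0_rows"
    by (rule card_subsemilattices_masks[of _ 3]) (simp_all add: A0_rows_def)
  moreover have "closed_count [] A0_rows = 122"
    by code_simp
  ultimately show ?thesis by simp
qed

lemma A0_semilattice: "join_semilattice_on A0 (\<union>)"
  by unfold_locales (auto simp: A0_def)

lemma card_A0: "card A0 = 8"
  by (simp add: A0_def card_Pow)

section \<open>Exhausting the semilattices with at most eight elements\<close>

lemma (in join_semilattice_on) planar_add_pendant:
  assumes fin: "finite L" and x: "x \<in> L" and y: "y \<in> L" "x \<noteq> y"
    and min: "\<forall>z\<in>L. le z x \<longrightarrow> z = x" and up: "\<forall>z\<in>L. z \<noteq> x \<longrightarrow> (le x z \<longleftrightarrow> le y z)"
    and rest: "planar_semilattice (L - {x}) join"
  shows "planar_semilattice L join"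
  unfolding planar_semilattice_def
proof (rule planar_poset_add_pendant[of L x y])
  show "planar_poset (L - {x}) le" using rest by (simp add: planar_semilattice_def)
  show "z = y" if "z \<in> L" "le y z" "le z y" for z using le_antisym[of z y] that y by simp
  show "le x z \<longleftrightarrow> le y z" if "z \<in> L" "z \<noteq> x" for z using up that by blast
  show "z = x" if "z \<in> L" "le z x" for z using min that by blast
qed (use fin x y le_refl in auto)

lemma (in join_semilattice_on) remove_minimal:
  assumes x: "x \<in> L" and y: "y \<in> L" "x \<noteq> y" and min: "\<forall>z\<in>L. le z x \<longrightarrow> z = x"
  shows "join_semilattice_on (L - {x}) join"
proof
  show "L - {x} \<noteq> {}" using y by blast
  fix a b c
  assume ab: "a \<in> L - {x}" "b \<in> L - {x}"
  have "join a b \<noteq> x"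
  proof
    assume "join a b = x"
    then have "le a x" using le_join(1)[of a b] ab by simp
    then show False using min ab by blast
  qed
  then show "join a b \<in> L - {x}" using closed ab by blast
  show "join a b = join b a" using commute ab by blast
  show "join a a = a" using idem ab by blast
  assume "c \<in> L - {x}"
  then show "join (join a b) c = join a (join b c)" using assoc ab by blast
qed

text \<open>The counter \<open>k\<close> is the number of elements that may still be added, so the exception for
  semilattices with few subsemilattices applies to the largest ones only. The bound is 122
  because \<open>closed_count\<close> includes the empty set.\<close>

primrec explore :: "nat \<Rightarrow> mask list \<Rightarrow> bool" where
  "explore 0 t =
    (if pendant_free (zeros t) t
     then (if settled t then True else closed_count [] (rev (full_rows t)) \<le> 122) else True)"
| "explore (Suc k) t =
    (if (if pendant_free (zeros t) t then settled t else True)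
     then list_all (\<lambda>U. if after U t then explore k (U # t) else True) (new_rows t) else False)"

text \<open>The only extensive computation: it visits 5581 matrices of size eight, of which 1059 are
  free of pendant elements.\<close>

lemma explored: "explore (Suc (Suc (Suc (Suc (Suc (Suc (Suc 0))))))) [[]]"
  by code_simp

context join_semilattice_on begin

lemma explore_sound:
  assumes "explore k (up_rows lt ds)" "listing (es @ ds)" "length es \<le> k"
    and "pendant_free (zeros (up_rows lt (es @ ds))) (up_rows lt (es @ ds))"
  shows "settled (up_rows lt (es @ ds)) \<or>
    length es = k \<and> closed_count [] (rev (full_rows (up_rows lt (es @ ds)))) \<le> 122"
  using assms
proof (induction k arbitrary: ds es)
  case 0
  then show ?case by (auto split: if_splits)
next
  case (Suc k)
  show ?case
  proof (cases es rule: rev_cases)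
    case Nil
    then show ?thesis using Suc.prems by (auto split: if_splits)
  next
    case (snoc es' x)
    then have l: "listing (es' @ (x # ds))" using Suc.prems by simp
    then have x: "listing (x # ds)" by (rule listing_append)
    have "\<forall>e\<in>set ds. \<not> le e x"
      using listing_up[of ds _ x] x by (auto simp: lt_def)
    then have new: "map (lt x) ds \<in> set (new_rows (up_rows lt ds))"
      using x row_in_new_rows by simp
    have "list_all (\<lambda>U. if after U (up_rows lt ds) then explore k (U # up_rows lt ds) else True)
      (new_rows (up_rows lt ds))"
      using Suc.prems(1) by (simp split: if_splits)
    then have "explore k (up_rows lt (x # ds))"
      using new x by (auto simp: list_all_iff)
    then have "settled (up_rows lt (es' @ (x # ds))) \<or>
        length es' = k \<and> closed_count [] (rev (full_rows (up_rows lt (es' @ (x # ds))))) \<le> 122"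
      using Suc.prems snoc l by (intro Suc.IH) simp_all
    then show ?thesis using snoc by simp
  qed
qed

lemma pendant_or_settled:
  assumes "finite L" "card L \<le> 8"
  shows "(\<exists>x\<in>L. \<exists>y\<in>L. x \<noteq> y \<and> (\<forall>z\<in>L. le z x \<longrightarrow> z = x) \<and> (\<forall>z\<in>L. z \<noteq> x \<longrightarrow> (le x z \<longleftrightarrow> le y z)))
    \<or> planar_semilattice L join \<or> card L = 8 \<and> card (subsemilattices L join) \<le> 121"
proof -
  obtain ds where ds: "listing ds" "set ds = L" using ex_listing assms(1) by blast
  then obtain es d where es: "ds = es @ [d]" using nonempty by (cases ds rule: rev_cases) auto
  have len: "length ds = card L" using ds listing_distinct distinct_card by metis
  show ?thesis
  proof (cases "pendant_free (zeros (up_rows lt ds)) (up_rows lt ds)")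
    case True
    have "explore 7 (up_rows lt [d])" using explored by (simp add: eval_nat_numeral)
    then have "settled (up_rows lt ds) \<or>
        length es = 7 \<and> closed_count [] (rev (full_rows (up_rows lt ds))) \<le> 122"
      using explore_sound[of 7 "[d]" es] ds True len es assms(2) by simp
    then show ?thesis
      using planar_if_settled[OF ds] card_subsemilattices_listing[OF ds] len es by auto
  next
    case False
    then show ?thesis using ex_pendant[OF ds] by blast
  qed
qed

end

lemma planar_if_card_le_7:
  assumes "join_semilattice_on L join" "finite L" "card L \<le> 7"
  shows "planar_semilattice L join"
  using assms
proof (induction "card L" arbitrary: L rule: less_induct)
  case less
  interpret join_semilattice_on L join by fact
  consider x y where "x \<in> L" "y \<in> L" "x \<noteq> y" "\<forall>z\<in>L. le z x \<longrightarrow> z = x"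
      "\<forall>z\<in>L. z \<noteq> x \<longrightarrow> (le x z \<longleftrightarrow> le y z)"
    | "planar_semilattice L join"
    using pendant_or_settled less.prems by fastforce
  then show ?case
  proof cases
    case 1
    have "card (L - {x}) < card L" using less.prems(2) 1(1) by (rule card_Diff1_less)
    then have "planar_semilattice (L - {x}) join"
      using less remove_minimal[OF 1(1-4)] by simp
    then show ?thesis using planar_add_pendant[OF less.prems(2) 1] by blast
  qed
qed

lemma planar_if_card_8:
  assumes "join_semilattice_on L join" "card L = 8" "card (subsemilattices L join) \<ge> 122"
  shows "planar_semilattice L join"
proof -
  interpret join_semilattice_on L join by fact
  have fin: "finite L" using assms(2) by (simp add: card_ge_0_finite)
  consider x y where "x \<in> L" "y \<in> L" "x \<noteq> y" "\<forall>z\<in>L. le z x \<longrightarrow> z = x"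
      "\<forall>z\<in>L. z \<noteq> x \<longrightarrow> (le x z \<longleftrightarrow> le y z)"
    | "planar_semilattice L join"
    using pendant_or_settled[OF fin] assms by fastforce
  then show ?thesis
  proof cases
    case 1
    have "card (L - {x}) = 7" using 1(1) assms(2) by simp
    then have "planar_semilattice (L - {x}) join"
      using planar_if_card_le_7[OF remove_minimal[OF 1(1-4)]] fin by simp
    then show ?thesis using planar_add_pendant[OF fin 1] by blast
  qed
qed

theorem mainTheorem3:
  "(\<forall>(L :: 'a set) join.
      join_semilattice_on L join \<and> finite L \<and> card L \<le> 7 \<longrightarrow> planar_semilattice L join) \<and>
   (join_semilattice_on A0 (\<union>) \<and> card A0 = 8 \<and> \<not> planar_semilattice A0 (\<union>) \<and>
      card (subsemilattices A0 (\<union>)) = 121) \<and>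
   (\<forall>(L :: 'b set) join.
      join_semilattice_on L join \<and> card L = 8 \<and> card (subsemilattices L join) \<ge> 122
        \<longrightarrow> planar_semilattice L join)"
  using planar_if_card_le_7 planar_if_card_8 A0_semilattice card_A0 A0_not_planar card_subsemilattices_A0
  by blast

end
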